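(* Let $(\Omega,\Sigma,\mu)$ be a measure space with $\mu(\Omega)=+\infty$ and let $p>1$. The set $L_p(\Omega)-\bigcup_{1\leq q<p}L_q(\Omega)$ is maximal spaceable in $L_p(\Omega)$ if either (a) $L_p(\Omega)-L_r(\Omega)\neq\emptyset$ for some $1\leq r<p$ and $\aleph_0\leq ent(\Omega)\leq\mathfrak{c}$; or (b) $(\Omega,\Sigma,\mu)$ is $\zeta$-bounded for some cardinal number $\zeta$ with $\mathfrak{c}\leq\zeta<ent(\Omega)$.
   Context: $L_s(\Omega)$ ($0<s<\infty$) is the space of $\mu$-a.e. classes of measurable $\mathbb{K}$-valued $f$ with $\int|f|^s d\mu<\infty$ (normed/quasi-normed as usual); $L_p(\Omega)-\bigcup_q L_q(\Omega)$ is the set of $f\in L_p(\Omega)$ lying in no $L_q(\Omega)$. A subset $M$ of a topological vector space $E$ is maximal spaceable if $M\cup\{0\}$ contains a closed linear subspace $F$ of $E$ with $\dim F=\dim E$ (algebraic dimensions). $\mathfrak{c}=\#\mathbb{R}$. $\Sigma_{fin}:=\{A\in\Sigma:\mu(A)<+\infty\}$; $A\sim B$ iff $\mu((A-B)\cup(B-A))=0$; $ent(\Omega):=\#(\Sigma_{fin}/\!\sim)$. The space is $\zeta$-bounded if every $A\in\Sigma_{fin}$ with $\mu(A)>0$ has at most $\zeta$ subsets of positive measure belonging to pairwise different classes of $\Sigma_{fin}/\!\sim$. *)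

theory Defs
  imports "HOL-Analysis.Analysis" "HOL-Library.Equipollence"
begin

text \<open>Scalars: a type 'k of class real_normed_field and banach (covers the real and the complex case).
  Elements of L_s are represented by measurable functions; mu-a.e. classes are handled by
  saturation (subspaces are unions of a.e. classes) and by "modulo null" linear algebra.\<close>

definition Ls :: "'a measure \<Rightarrow> real \<Rightarrow> ('a \<Rightarrow> 'k::{real_normed_field,banach}) set" where
  "Ls M s = {f \<in> borel_measurable M. integrable M (\<lambda>x. norm (f x) powr s)}"

definition Lp_dist :: "'a measure \<Rightarrow> real \<Rightarrow> ('a \<Rightarrow> 'k::{real_normed_field,banach}) \<Rightarrow> ('a \<Rightarrow> 'k) \<Rightarrow> real" where
  "Lp_dist M p f g = (\<integral>x. norm (f x - g x) powr p \<partial>M) powr (1 / p)"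

definition lin_indep_ae :: "'a measure \<Rightarrow> ('a \<Rightarrow> 'k::{real_normed_field,banach}) set \<Rightarrow> bool" where
  "lin_indep_ae M B \<longleftrightarrow>
     (\<forall>F c. finite F \<longrightarrow> F \<subseteq> B \<longrightarrow> (AE x in M. (\<Sum>b\<in>F. c b * b x) = 0) \<longrightarrow> (\<forall>b\<in>F. c b = 0))"

definition spans_ae :: "'a measure \<Rightarrow> ('a \<Rightarrow> 'k::{real_normed_field,banach}) set \<Rightarrow> ('a \<Rightarrow> 'k) set \<Rightarrow> bool" where
  "spans_ae M B S \<longleftrightarrow>
     (\<forall>f\<in>S. \<exists>F c. finite F \<and> F \<subseteq> B \<and> (AE x in M. f x = (\<Sum>b\<in>F. c b * b x)))"

definition hamel_basis_ae :: "'a measure \<Rightarrow> ('a \<Rightarrow> 'k::{real_normed_field,banach}) set \<Rightarrow> ('a \<Rightarrow> 'k) set \<Rightarrow> bool" where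
  "hamel_basis_ae M B S \<longleftrightarrow> B \<subseteq> S \<and> lin_indep_ae M B \<and> spans_ae M B S"

definition closed_subspace_Lp :: "'a measure \<Rightarrow> real \<Rightarrow> ('a \<Rightarrow> 'k::{real_normed_field,banach}) set \<Rightarrow> bool" where
  "closed_subspace_Lp M p S \<longleftrightarrow>
     S \<subseteq> Ls M p \<and>
     (\<lambda>x. 0) \<in> S \<and>
     (\<forall>f\<in>S. \<forall>g\<in>S. (\<lambda>x. f x + g x) \<in> S) \<and>
     (\<forall>c. \<forall>f\<in>S. (\<lambda>x. c * f x) \<in> S) \<and>
     (\<forall>f\<in>S. \<forall>g\<in>Ls M p. (AE x in M. f x = g x) \<longrightarrow> g \<in> S) \<and>
     (\<forall>f\<in>Ls M p. (\<forall>e>0. \<exists>g\<in>S. Lp_dist M p f g < e) \<longrightarrow> f \<in> S)"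

definition maximal_spaceable_Lp :: "'a measure \<Rightarrow> real \<Rightarrow> ('a \<Rightarrow> 'k::{real_normed_field,banach}) set \<Rightarrow> bool" where
  "maximal_spaceable_Lp M p T \<longleftrightarrow>
     (\<exists>S B C. closed_subspace_Lp M p S \<and>
        (\<forall>f\<in>S. f \<in> T \<or> (AE x in M. f x = 0)) \<and>
        hamel_basis_ae M B S \<and> hamel_basis_ae M C (Ls M p :: ('a \<Rightarrow> 'k) set) \<and> B \<approx> C)"

definition fin_sets :: "'a measure \<Rightarrow> 'a set set" where
  "fin_sets M = {A \<in> sets M. emeasure M A < \<infinity>}"

definition ae_sim :: "'a measure \<Rightarrow> ('a set \<times> 'a set) set" where
  "ae_sim M = {(A, B). A \<in> fin_sets M \<and> B \<in> fin_sets M \<and> emeasure M ((A - B) \<union> (B - A)) = 0}"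

text \<open>Sigma_fin / ~ ; its cardinality is ent(Omega).\<close>
definition ent_classes :: "'a measure \<Rightarrow> 'a set set set" where
  "ent_classes M = fin_sets M // ae_sim M"

text \<open>zeta-boundedness, the cardinal zeta being given as the cardinality of a set Z.\<close>
definition zeta_bounded :: "'a measure \<Rightarrow> 'z set \<Rightarrow> bool" where
  "zeta_bounded M Z \<longleftrightarrow>
     (\<forall>A\<in>fin_sets M. emeasure M A > 0 \<longrightarrow>
        {ae_sim M `` {B} | B. B \<in> sets M \<and> B \<subseteq> A \<and> emeasure M B > 0} \<lesssim> Z)"

end

theory Submission
  imports Defs "HOL-Real_Asymp.Real_Asymp"
begin

text \<open>Let \<open>(D\<^sub>j)\<close>, \<open>j \<in> J\<close>, be almost disjoint sets carrying functions \<open>h\<^sub>j\<close> that lie in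
  \<open>L\<^sub>p\<close> but in no \<open>L\<^sub>q\<close> with \<open>q < p\<close>. The functions that are a multiple of \<open>h\<^sub>j\<close> on each
  \<open>D\<^sub>j\<close> and vanish off the \<open>D\<^sub>j\<close> form a closed subspace all of whose nonzero elements avoid
  every \<open>L\<^sub>q\<close>. Its dimension is at least the number of sequences in \<open>J\<close>: the branches of the tree
  of finite sequences in \<open>J\<close> are almost disjoint countable subsets of a copy of \<open>J\<close>, so the
  corresponding series of the \<open>h\<^sub>j\<close> are independent. A function in \<open>L\<^sub>p\<close> is determined by
  countably many of its level sets, so the dimension of \<open>L\<^sub>p\<close> is at most the number of sequences
  in \<open>\<Sigma>\<^sub>f\<^sub>i\<^sub>n/\<sim>\<close>. It remains to find \<open>J\<close> with at least as many sequences.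

  In case (a), the dyadic level sets of a function in \<open>L\<^sub>p - L\<^sub>r\<close> have measure at least 1
  infinitely often, and a countable \<open>J\<close> suffices. In case (b), take a maximal almost disjoint family
  \<open>I\<close> of sets all of whose nonnull subsets have equally many classes. Every set of finite measure
  is covered by a sequence in \<open>I\<close>, and the classes covered by a fixed sequence number at most
  \<open>\<zeta>\<close>. As \<open>ent(\<Omega>) > \<zeta>\<close>, there are more than \<open>\<zeta>\<close> sequences in \<open>I\<close>, hence at least
  \<open>ent(\<Omega>)\<close> of them, and grouping members of \<open>I\<close> of comparable measure yields the \<open>D\<^sub>j\<close>.\<close>

subsection \<open>Cardinalities of sequence spaces\<close>

text \<open>Represents the cardinal power of \<open>X\<close> with exponent aleph_0, so that its
  arithmetic can be done with explicit injections.\<close>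

definition seqs :: "'x set \<Rightarrow> (nat \<Rightarrow> 'x) set" where
  "seqs X = {f. \<forall>n. f n \<in> X}"

lemma lepoll_linear: "A \<lesssim> B \<or> B \<lesssim> A"
  unfolding lepoll_def using ordLeq_total[OF card_of_Well_order card_of_Well_order, of A B]
  by (simp flip: card_of_ordLeq)

lemma lepoll_times_self: "infinite X \<Longrightarrow> X \<times> X \<lesssim> X"
  unfolding lepoll_def card_of_ordLeq
  by (intro ordIso_imp_ordLeq card_of_Times_same_infinite)

text \<open>An element of the union is recorded by one chosen index together with its image under
  the injection belonging to that index.\<close>

lemma UN_lepoll_times:
  assumes "\<And>x. x \<in> X \<Longrightarrow> F x \<lesssim> Y"
  shows "(\<Union>x\<in>X. F x) \<lesssim> X \<times> Y"
proof -
  have "\<forall>x\<in>X. \<exists>g. inj_on g (F x) \<and> g ` F x \<subseteq> Y"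
    using assms unfolding lepoll_def by blast
  then obtain g where g: "\<And>x. x \<in> X \<Longrightarrow> inj_on (g x) (F x) \<and> g x ` F x \<subseteq> Y"
    by metis
  have "\<forall>y\<in>(\<Union>x\<in>X. F x). \<exists>x\<in>X. y \<in> F x" by blast
  then obtain s where s: "\<And>y. y \<in> (\<Union>x\<in>X. F x) \<Longrightarrow> s y \<in> X \<and> y \<in> F (s y)"
    by metis
  show ?thesis unfolding lepoll_def
  proof (intro exI conjI)
    show "inj_on (\<lambda>y. (s y, g (s y) y)) (\<Union>x\<in>X. F x)"
    proof (rule inj_onI)
      fix y z assume yz: "y \<in> (\<Union>x\<in>X. F x)" "z \<in> (\<Union>x\<in>X. F x)"
        "(s y, g (s y) y) = (s z, g (s z) z)"
      then have "g (s y) y = g (s y) z" "z \<in> F (s y)" using s by auto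
      then show "y = z" using g[of "s y"] s[of y] yz by (auto dest: inj_onD)
    qed
    show "(\<lambda>y. (s y, g (s y) y)) ` (\<Union>x\<in>X. F x) \<subseteq> X \<times> Y"
      using s g by blast
  qed
qed

lemma seqs_mono:
  assumes "X \<lesssim> Y" shows "seqs X \<lesssim> seqs Y"
proof -
  obtain g where g: "inj_on g X" "g ` X \<subseteq> Y" using assms unfolding lepoll_def by blast
  show ?thesis unfolding lepoll_def
  proof (intro exI conjI)
    show "inj_on (\<lambda>f. g \<circ> f) (seqs X)"
    proof (rule inj_onI, rule ext)
      fix f h n assume "f \<in> seqs X" "h \<in> seqs X" "g \<circ> f = g \<circ> h"
      then show "f n = h n" using inj_onD[OF g(1), of "f n" "h n"]
        by (auto simp: seqs_def dest: fun_cong[of _ _ n])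
    qed
    show "(\<lambda>f. g \<circ> f) ` seqs X \<subseteq> seqs Y" using g(2) unfolding seqs_def by auto
  qed
qed

text \<open>Cantor pairing flattens a double sequence into a single one.\<close>

lemma seqs_seqs: "seqs (seqs X) \<lesssim> seqs X"
  unfolding lepoll_def
proof (intro exI conjI)
  let ?h = "\<lambda>f n. f (fst (prod_decode n)) (snd (prod_decode n))"
  show "inj_on ?h (seqs (seqs X))"
  proof (rule inj_onI, intro ext)
    fix f g :: "nat \<Rightarrow> nat \<Rightarrow> 'a" and m n
    assume "?h f = ?h g"
    from fun_cong[OF this, of "prod_encode (m, n)"] show "f m n = g m n" by simp
  qed
  show "?h ` seqs (seqs X) \<subseteq> seqs X" unfolding seqs_def by auto
qed

text \<open>Two sequences are interleaved over the even and the odd positions.\<close>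

lemma seqs_times_self: "seqs X \<times> seqs X \<lesssim> seqs X"
  unfolding lepoll_def
proof (intro exI conjI)
  let ?h = "\<lambda>(f, g) n. if even n then f (n div 2) else g (n div 2)"
  show "inj_on ?h (seqs X \<times> seqs X)"
  proof (rule inj_onI, clarify)
    fix f g f' g' :: "nat \<Rightarrow> 'a"
    assume e: "(\<lambda>n. if even n then f (n div 2) else g (n div 2)) =
               (\<lambda>n. if even n then f' (n div 2) else g' (n div 2))"
    have "f n = f' n" for n using fun_cong[OF e, of "2 * n"] by simp
    moreover have "g n = g' n" for n using fun_cong[OF e, of "2 * n + 1"] by simp
    ultimately show "f = f' \<and> g = g'" by auto
  qed
  show "?h ` (seqs X \<times> seqs X) \<subseteq> seqs X" unfolding seqs_def by auto
qed

lemma nat_set_lepoll_seqs: "(UNIV :: nat set set) \<lesssim> seqs (UNIV :: nat set)"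
  unfolding lepoll_def
proof (intro exI conjI)
  show "inj_on (\<lambda>(A :: nat set) n. if n \<in> A then 1 else (0::nat)) UNIV"
  proof (rule inj_onI)
    fix A B :: "nat set"
    assume e: "(\<lambda>n. if n \<in> A then 1 else (0::nat)) = (\<lambda>n. if n \<in> B then 1 else 0)"
    have "n \<in> A \<longleftrightarrow> n \<in> B" for n using fun_cong[OF e, of n] by (auto split: if_splits)
    then show "A = B" by blast
  qed
qed (auto simp: seqs_def)

text \<open>A sequence of sets of naturals is a set of index pairs, which pairing turns into a set
  of naturals.\<close>

lemma seqs_nat_set: "seqs (UNIV :: nat set set) \<lesssim> (UNIV :: nat set set)"
  unfolding lepoll_def
proof (intro exI conjI)
  let ?h = "\<lambda>f. {n. snd (prod_decode n) \<in> f (fst (prod_decode n))}"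
  show "inj_on ?h (seqs (UNIV :: nat set set))"
  proof (rule inj_onI, intro ext set_eqI)
    fix f g :: "nat \<Rightarrow> nat set" and m n
    assume "?h f = ?h g"
    then have "prod_encode (m, n) \<in> ?h f \<longleftrightarrow> prod_encode (m, n) \<in> ?h g" by simp
    then show "n \<in> f m \<longleftrightarrow> n \<in> g m" by simp
  qed
qed auto

lemma reals_lepoll_seqs_nat: "(UNIV :: real set) \<lesssim> seqs (UNIV :: nat set)"
  using nat_set_lepoll_seqs nat_sets_eqpoll_reals eqpoll_sym lepoll_trans1 by blast

lemma seqs_reals: "seqs (UNIV :: real set) \<lesssim> (UNIV :: real set)"
proof -
  have "seqs (UNIV :: real set) \<lesssim> seqs (UNIV :: nat set set)"
    by (intro seqs_mono eqpoll_imp_lepoll eqpoll_sym[OF nat_sets_eqpoll_reals])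
  also note seqs_nat_set
  also have "(UNIV :: nat set set) \<lesssim> (UNIV :: real set)"
    by (rule eqpoll_imp_lepoll[OF nat_sets_eqpoll_reals])
  finally show ?thesis .
qed

text \<open>An injection of \<open>J \<times> J\<close> into \<open>J\<close> is folded over the
  list. The length is stored as well, since the fold separates only lists of equal length.\<close>

lemma lists_inject:
  assumes "infinite J"
  obtains e :: "'j list \<Rightarrow> 'j" where "inj_on e (lists J)" "e ` lists J \<subseteq> J"
proof -
  obtain \<pi> where \<pi>: "inj_on \<pi> (J \<times> J)" "\<pi> ` (J \<times> J) \<subseteq> J"
    using lepoll_times_self[OF assms] unfolding lepoll_def by blast
  obtain \<nu> :: "nat \<Rightarrow> 'j" where \<nu>: "inj \<nu>" "range \<nu> \<subseteq> J"
    using infinite_countable_subset[OF assms] by blast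
  \<comment> \<open>\<open>\<nu> 0\<close> is an arbitrary start value. It may itself be the code of
    a pair, and so lists of different lengths can collide.\<close>
  define c where "c = (\<lambda>xs. foldr (\<lambda>x y. \<pi> (x, y)) xs (\<nu> 0))"
  have cJ: "c xs \<in> J" if "xs \<in> lists J" for xs
    using that by (induction xs) (use \<nu> \<pi> in \<open>auto simp: c_def\<close>)
  have cinj: "xs = ys" if "xs \<in> lists J" "ys \<in> lists J" "length xs = length ys" "c xs = c ys" for xs ys
    using that
  proof (induction xs arbitrary: ys rule: list.induct)
    case (Cons x xs)
    then obtain y ys' where y: "ys = y # ys'" by (cases ys) auto
    have m: "(x, c xs) \<in> J \<times> J" "(y, c ys') \<in> J \<times> J"
      using Cons.prems y cJ by auto
    have "\<pi> (x, c xs) = \<pi> (y, c ys')" using Cons.prems y by (simp add: c_def)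
    then have "(x, c xs) = (y, c ys')" using inj_onD[OF \<pi>(1) _ m] by blast
    then show ?case using Cons y by auto
  qed auto
  show ?thesis
  proof
    show "inj_on (\<lambda>xs. \<pi> (\<nu> (length xs), c xs)) (lists J)"
    proof (rule inj_onI)
      fix xs ys assume l: "xs \<in> lists J" "ys \<in> lists J"
        and e: "\<pi> (\<nu> (length xs), c xs) = \<pi> (\<nu> (length ys), c ys)"
      have "(\<nu> (length xs), c xs) = (\<nu> (length ys), c ys)"
        using inj_onD[OF \<pi>(1) e] l cJ \<nu> by blast
      then show "xs = ys" using cinj l \<nu>(1) by (auto dest: injD)
    qed
    show "(\<lambda>xs. \<pi> (\<nu> (length xs), c xs)) ` lists J \<subseteq> J"
      using cJ \<nu> \<pi> by blast
  qed
qed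

subsection \<open>The scalar field\<close>

text \<open>A pair \<open>(u, v)\<close> stands for \<open>u + i v\<close> in the complexification of the field, where
  \<open>sq_iter w n\<close> is \<open>w ^ 2 ^ n\<close> and \<open>nrm2 w s\<close> is the product of \<open>w - s\<close> and its conjugate.\<close>
fun sq_iter :: "'k::comm_ring_1 \<times> 'k \<Rightarrow> nat \<Rightarrow> 'k \<times> 'k" where
  "sq_iter w 0 = w"
| "sq_iter w (Suc n) = (let (u, v) = sq_iter w n in (u * u - v * v, 2 * u * v))"

definition nrm2 :: "'k::real_normed_field \<times> 'k \<Rightarrow> complex \<Rightarrow> 'k" where
  "nrm2 w s = (fst w - of_real (Re s)) * (fst w - of_real (Re s))
            + (snd w - of_real (Im s)) * (snd w - of_real (Im s))"

text \<open>The factorisation w^2 - s^2 = (w - s)(w + s), multiplied by its conjugate.\<close>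

lemma nrm2_sq:
  "nrm2 (sq_iter w (Suc n)) (s * s) = nrm2 (sq_iter w n) s * nrm2 (sq_iter w n) (- s)"
  by (cases "sq_iter w n") (simp add: nrm2_def algebra_simps)

text \<open>Every complex \<open>s\<close> is a square, so the value at level \<open>n + 1\<close>
  is a product of two values at level \<open>n\<close>, taken at the two square roots of
  \<open>s\<close>.\<close>

lemma nrm2_lower:
  assumes "\<And>s. m \<le> norm (nrm2 w s)" "m > 0"
  shows "m ^ (2 ^ n) \<le> norm (nrm2 (sq_iter w n) s)"
proof (induction n arbitrary: s)
  case (Suc n)
  have "m ^ (2 ^ Suc n) = m ^ (2 ^ n) * m ^ (2 ^ n)" by (simp add: mult_2 flip: power_add)
  also have "\<dots> \<le> norm (nrm2 (sq_iter w n) (csqrt s)) * norm (nrm2 (sq_iter w n) (- csqrt s))"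
    using Suc assms(2) by (intro mult_mono) auto
  also have "\<dots> = norm (nrm2 (sq_iter w (Suc n)) (csqrt s * csqrt s))"
    by (simp only: nrm2_sq norm_mult)
  also have "csqrt s * csqrt s = s" by (metis power2_csqrt power2_eq_square)
  finally show ?case .
qed (use assms in simp)

text \<open>At powers of \<open>r\<close>, one of the two factors in \<open>nrm2_sq\<close> is again
  taken at a power of \<open>r\<close>. This keeps the exact factor \<open>norm (nrm2 w r)\<close>,
  while the remaining \<open>2 ^ n - 1\<close> factors are estimated by \<open>m\<close>.\<close>

lemma nrm2_lower':
  assumes "\<And>s. m \<le> norm (nrm2 w s)" "m > 0"
  shows "norm (nrm2 w r) * m ^ (2 ^ n - 1) \<le> norm (nrm2 (sq_iter w n) (r ^ (2 ^ n)))"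
proof (induction n)
  case (Suc n)
  have e: "(2::nat) ^ Suc n - 1 = (2 ^ n - 1) + 2 ^ n" by simp
  have "norm (nrm2 w r) * m ^ (2 ^ Suc n - 1) = (norm (nrm2 w r) * m ^ (2 ^ n - 1)) * m ^ (2 ^ n)"
    by (simp only: e power_add mult.assoc)
  also have "\<dots> \<le> norm (nrm2 (sq_iter w n) (r ^ (2 ^ n))) * norm (nrm2 (sq_iter w n) (- (r ^ (2 ^ n))))"
    using Suc assms(2) nrm2_lower[OF assms] by (intro mult_mono) auto
  also have "\<dots> = norm (nrm2 (sq_iter w (Suc n)) (r ^ (2 ^ n) * r ^ (2 ^ n)))"
    by (simp only: nrm2_sq norm_mult)
  also have "r ^ (2 ^ n) * r ^ (2 ^ n) = r ^ (2 ^ Suc n)"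
    by (simp add: mult_2 flip: power_add)
  finally show ?case .
qed simp

text \<open>The sum of the norms of both components is submultiplicative under squaring.\<close>

lemma sq_iter_norm:
  fixes w :: "'k::real_normed_field \<times> 'k"
  shows "norm (fst (sq_iter w n)) + norm (snd (sq_iter w n)) \<le> (norm (fst w) + norm (snd w)) ^ (2 ^ n)"
proof (induction n)
  case (Suc n)
  obtain u v where uv: "sq_iter w n = (u, v)" by fastforce
  have "norm (u * u - v * v) \<le> norm u * norm u + norm v * norm v"
    by (metis norm_mult norm_triangle_ineq4)
  then have "norm (u * u - v * v) + norm (2 * u * v) \<le> (norm u + norm v) * (norm u + norm v)"
    by (simp add: norm_mult algebra_simps)
  also have "\<dots> \<le> (norm (fst w) + norm (snd w)) ^ (2 ^ n) * (norm (fst w) + norm (snd w)) ^ (2 ^ n)"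
    using Suc uv by (intro mult_mono) auto
  also have "\<dots> = (norm (fst w) + norm (snd w)) ^ (2 ^ Suc n)" by (simp add: mult_2 flip: power_add)
  finally show ?case using uv by simp
qed simp

lemma sq_iter_norm2: "nrm2 (sq_iter w n) 0 = nrm2 w 0 ^ (2 ^ n)"
proof (induction n)
  case (Suc n)
  have "nrm2 (sq_iter w (Suc n)) 0 = nrm2 (sq_iter w n) 0 * nrm2 (sq_iter w n) 0"
    using nrm2_sq[of w n 0] by simp
  then show ?case using Suc by (simp add: mult_2 power_add del: sq_iter.simps)
qed simp

lemma nrm2_expand:
  "nrm2 w s = nrm2 w 0 - 2 * (of_real (Re s) * fst w + of_real (Im s) * snd w) + of_real ((cmod s)\<^sup>2)"
  unfolding cmod_power2 by (simp add: nrm2_def power2_eq_square algebra_simps)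

lemma nrm2_upper:
  fixes w :: "'k::real_normed_field \<times> 'k"
  shows "norm (nrm2 w s) \<le> norm (nrm2 w 0) + 2 * cmod s * (norm (fst w) + norm (snd w)) + (cmod s)\<^sup>2"
proof -
  have "norm (nrm2 w s) \<le> norm (nrm2 w 0 - 2 * (of_real (Re s) * fst w + of_real (Im s) * snd w))
      + norm (of_real ((cmod s)\<^sup>2) :: 'k)"
    unfolding nrm2_expand[of w s] by (rule norm_triangle_ineq)
  also have "\<dots> \<le> norm (nrm2 w 0) + norm (2 * (of_real (Re s) * fst w + of_real (Im s) * snd w))
      + norm (of_real ((cmod s)\<^sup>2) :: 'k)"
    by (intro add_right_mono norm_triangle_ineq4)
  also have "norm (2 * (of_real (Re s) * fst w + of_real (Im s) * snd w))
      \<le> 2 * (norm (of_real (Re s) * fst w) + norm (of_real (Im s) * snd w))"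
    using norm_triangle_ineq[of "of_real (Re s) * fst w" "of_real (Im s) * snd w"]
    unfolding norm_mult[of 2] by simp
  also have "norm (of_real (Re s) * fst w) + norm (of_real (Im s) * snd w)
      \<le> cmod s * norm (fst w) + cmod s * norm (snd w)"
    by (intro add_mono) (auto simp: norm_mult abs_Re_le_cmod abs_Im_le_cmod intro!: mult_right_mono)
  finally show ?thesis unfolding norm_of_real by (simp add: algebra_simps)
qed

text \<open>Near a minimiser the bound of \<open>nrm2_upper\<close> at level \<open>n\<close> is a factor
  \<open>1 + o(1)\<close> away from the lower bound, so that the minimum is attained on a whole disc.\<close>
lemma nrm2_const_near_min:
  fixes w :: "'k::real_normed_field \<times> 'k"
  assumes m: "\<And>s. m \<le> norm (nrm2 w s)" "m > 0" "norm (nrm2 w 0) = m"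
    and r: "cmod r * (norm (fst w) + norm (snd w)) < m" "(cmod r)\<^sup>2 < m"
  shows "norm (nrm2 w r) = m"
proof -
  define C where "C = norm (fst w) + norm (snd w)"
  have C0: "C \<ge> 0" by (simp add: C_def)
  \<comment> \<open>After division by \<open>m ^ (2 ^ n)\<close>, the error terms of
    \<open>nrm2_upper\<close> at level \<open>n\<close> become powers of \<open>a\<close> and
    \<open>b\<close> with exponent \<open>2 ^ n\<close>. Both ratios are below 1 by the conditions
    on \<open>r\<close>.\<close>
  define a where "a = cmod r * C / m"
  define b where "b = (cmod r)\<^sup>2 / m"
  have ab: "0 \<le> a" "a < 1" "0 \<le> b" "b < 1"
    using m r C0 by (auto simp: a_def b_def C_def)
  have le: "norm (nrm2 w r) / m \<le> 1 + 2 * a ^ (2 ^ n) + b ^ (2 ^ n)" for n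
  proof -
    have "norm (nrm2 w r) * m ^ (2 ^ n - 1) \<le> norm (nrm2 (sq_iter w n) (r ^ (2 ^ n)))"
      by (rule nrm2_lower'[OF m(1,2)])
    also have "\<dots> \<le> norm (nrm2 (sq_iter w n) 0)
        + 2 * cmod (r ^ (2 ^ n)) * (norm (fst (sq_iter w n)) + norm (snd (sq_iter w n))) + (cmod (r ^ (2 ^ n)))\<^sup>2"
      by (rule nrm2_upper)
    also have "\<dots> \<le> m ^ (2 ^ n) + 2 * cmod r ^ (2 ^ n) * C ^ (2 ^ n) + ((cmod r)\<^sup>2) ^ (2 ^ n)"
      using sq_iter_norm[of w n] m(3)
      by (intro add_mono mult_mono)
        (auto simp: sq_iter_norm2 norm_power C_def power_mult[symmetric] mult.commute)
    finally have "norm (nrm2 w r) * m ^ (2 ^ n - 1) / m ^ (2 ^ n)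
        \<le> (m ^ (2 ^ n) + 2 * cmod r ^ (2 ^ n) * C ^ (2 ^ n) + ((cmod r)\<^sup>2) ^ (2 ^ n)) / m ^ (2 ^ n)"
      using m(2) by (intro divide_right_mono) auto
    also have "\<dots> = 1 + 2 * a ^ (2 ^ n) + b ^ (2 ^ n)"
      using m(2) by (simp add: a_def b_def field_simps)
    also have "m ^ (2 ^ n) = m ^ (2 ^ n - 1) * m"
      by (metis power_minus_mult zero_less_numeral zero_less_power)
    finally show ?thesis using m(2) by simp
  qed
  have sub: "filterlim (\<lambda>n. 2 ^ n :: nat) at_top sequentially"
    by (rule filterlim_subseq) (auto simp: strict_mono_def)
  have "(\<lambda>n. 1 + 2 * a ^ (2 ^ n) + b ^ (2 ^ n)) \<longlonglongrightarrow> 1 + 2 * 0 + 0"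
    using ab by (intro tendsto_intros filterlim_compose[OF LIMSEQ_realpow_zero sub]) auto
  then have "norm (nrm2 w r) / m \<le> 1"
    using LIMSEQ_le_const[of _ 1 "norm (nrm2 w r) / m"] le by auto
  then show ?thesis using m(1)[of r] m(2) by (simp add: field_simps)
qed

text \<open>At \<open>z\<close> with real part a and imaginary part b, \<open>\<phi>\<close> is the
  norm of (x - a)^2 + b^2. It has a minimum because it grows at infinity. A positive minimum would
  be attained on a set both closed and open, hence on the whole plane, against the growth.\<close>

lemma real_normed_field_quadratic:
  fixes x :: "'k::real_normed_field"
  obtains a b :: real where "(x - of_real a) * (x - of_real a) = - of_real (b * b)"
proof -
  define \<phi> where "\<phi> = (\<lambda>z. norm (nrm2 (x, 0) z))"
  have cont: "continuous_on UNIV \<phi>"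
    unfolding \<phi>_def nrm2_def by (intro continuous_intros)
  \<comment> \<open>Far out the quadratic term of \<open>nrm2_expand\<close> dominates, so a
    minimiser over the disc of radius \<open>R\<close> is a global one.\<close>
  have big: "\<phi> z > \<phi> 0" if z: "cmod z > 2 * norm x + 1 + \<phi> 0" for z
  proof -
    have "cmod z * cmod z \<le> \<phi> z + norm (x * x) + 2 * cmod z * norm x"
    proof -
      have e: "(of_real ((cmod z)\<^sup>2) :: 'k) = nrm2 (x, 0) z - x * x + 2 * (of_real (Re z) * x)"
        by (subst nrm2_expand) (simp add: nrm2_def)
      have "(cmod z)\<^sup>2 = norm (of_real ((cmod z)\<^sup>2) :: 'k)" unfolding norm_of_real by simp
      also have "\<dots> \<le> \<phi> z + norm (x * x) + norm (2 * (of_real (Re z) * x))"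
        unfolding e \<phi>_def by (metis (no_types, opaque_lifting) add_mono norm_triangle_ineq norm_triangle_ineq4 order_refl order_trans)
      also have "norm (2 * (of_real (Re z) * x)) \<le> 2 * cmod z * norm x"
        by (auto simp: norm_mult abs_Re_le_cmod intro!: mult_right_mono)
      finally show ?thesis by (simp add: power2_eq_square)
    qed
    moreover have "norm (x * x) = \<phi> 0" by (simp add: \<phi>_def nrm2_def)
    moreover have p0: "\<phi> 0 \<ge> 0" by (simp add: \<phi>_def)
    ultimately have 1: "cmod z * (cmod z - 2 * norm x) \<le> \<phi> z + \<phi> 0" by (simp add: algebra_simps)
    have "(1 + 2 * \<phi> 0 - \<phi> 0) * (1 + \<phi> 0) \<le> cmod z * (cmod z - 2 * norm x)"
      using z p0 by (intro mult_mono) (smt (verit) norm_ge_zero)+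
    moreover have "(1 + 2 * \<phi> 0 - \<phi> 0) * (1 + \<phi> 0) \<ge> 1 + 2 * \<phi> 0"
      using p0 by (simp add: algebra_simps)
    ultimately show ?thesis using 1 p0 by linarith
  qed
  define R where "R = 2 * norm x + 1 + \<phi> 0"
  have R0: "R > 0" unfolding R_def \<phi>_def by (smt (verit) norm_ge_zero)
  have "\<exists>z0\<in>cball 0 R. \<forall>z\<in>cball 0 R. \<phi> z0 \<le> \<phi> z"
    using R0 by (intro continuous_attains_inf continuous_on_subset[OF cont]) auto
  then obtain z0 where "\<forall>z\<in>cball 0 R. \<phi> z0 \<le> \<phi> z" by blast
  then have z0: "\<phi> z0 \<le> \<phi> z" if "cmod z \<le> R" for z using that by simp
  have min: "\<phi> z0 \<le> \<phi> z" for z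
    using z0[of z] z0[of 0] big[of z] R0 unfolding R_def[symmetric] by fastforce
  define m where "m = \<phi> z0"
  \<comment> \<open>Translation moves a minimiser to the origin, where
    \<open>nrm2_const_near_min\<close> expects it.\<close>
  have shift: "nrm2 (x, 0) (z + s) = nrm2 (x - of_real (Re z), - of_real (Im z)) s" for z s
    by (simp add: nrm2_def algebra_simps)
  have "m = 0"
  proof (rule ccontr)
    assume "m \<noteq> 0"
    then have m0: "m > 0" by (simp add: m_def \<phi>_def)
    define S where "S = {z. \<phi> z = m}"
    have "closed S"
      unfolding S_def using continuous_closed_vimage[of "{m}" \<phi>] cont
      by (simp add: continuous_on_eq_continuous_at vimage_def)
    moreover have "open S"
      unfolding open_contains_ball
    proof (intro ballI)
      fix z assume "z \<in> S"
      then have zS: "\<phi> z = m" by (simp add: S_def)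
      define w where "w = (x - of_real (Re z), - of_real (Im z) :: 'k)"
      define C where "C = norm (fst w) + norm (snd w)"
      \<comment> \<open>The radius meets both smallness conditions of
        \<open>nrm2_const_near_min\<close>; the bound 1 reduces the square of \<open>cmod r\<close>
        to \<open>cmod r\<close>.\<close>
      define e where "e = min (m / (C + 1)) (min m 1)"
      have C0: "C \<ge> 0" by (simp add: C_def)
      have e0: "e > 0" using m0 C0 by (simp add: e_def)
      have "\<phi> y = m" if "y \<in> ball z e" for y
      proof -
        define r where "r = y - z"
        have r: "cmod r < e" using that by (simp add: r_def dist_norm norm_minus_commute)
        have "cmod r * C \<le> cmod r * (C + 1)" using C0 by (simp add: mult_left_mono)
        also have "\<dots> < m / (C + 1) * (C + 1)"
          using r C0 by (intro mult_strict_right_mono) (auto simp: e_def)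
        also have "\<dots> = m" using C0 by simp
        finally have 1: "cmod r * C < m" .
        have "(cmod r)\<^sup>2 \<le> cmod r * 1" unfolding power2_eq_square
          using r by (intro mult_left_mono) (auto simp: e_def)
        then have 2: "(cmod r)\<^sup>2 < m" using r by (auto simp: e_def)
        have "norm (nrm2 w r) = m"
        proof (rule nrm2_const_near_min)
          show "m \<le> norm (nrm2 w s)" for s
            using min[of "z + s"] shift[of z s] by (simp add: m_def \<phi>_def w_def)
          show "norm (nrm2 w 0) = m"
            using zS shift[of z 0] by (simp add: \<phi>_def w_def)
        qed (use m0 1 2 in \<open>auto simp: C_def\<close>)
        then show ?thesis using shift[of z r] by (simp add: \<phi>_def w_def r_def)
      qed
      then show "\<exists>e>0. ball z e \<subseteq> S" using e0 by (auto simp: S_def)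
    qed
    ultimately have "S = {} \<or> S = UNIV"
      using clopen by blast
    moreover have "z0 \<in> S" by (simp add: S_def m_def)
    ultimately have "\<phi> (of_real (R + 1)) = m" "\<phi> 0 = m" unfolding S_def by auto
    moreover have "cmod (of_real (R + 1)) = R + 1" unfolding norm_of_real using R0 by simp
    ultimately show False using big[of "of_real (R + 1)"] R_def by linarith
  qed
  then have "nrm2 (x, 0) z0 = 0" by (simp add: m_def \<phi>_def)
  then have "(x - of_real (Re z0)) * (x - of_real (Re z0)) = - of_real (Im z0 * Im z0)"
    by (simp add: nrm2_def eq_neg_iff_add_eq_0)
  then show ?thesis by (rule that)
qed

text \<open>A weak form of the Gelfand--Mazur theorem, which makes up for the missing second countability
  of the scalars when measurability of sums is needed.\<close>
lemma real_normed_field_coordinates: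
  obtains \<phi> :: "'k::real_normed_field \<Rightarrow> complex" and \<psi> :: "complex \<Rightarrow> 'k"
  where "bounded_linear \<phi>" "bounded_linear \<psi>" "\<And>x. \<psi> (\<phi> x) = x"
proof (cases "\<forall>x::'k. x \<in> \<real>")
  case True
  define g where "g = (\<lambda>x::'k. THE r. x = of_real r)"
  have g: "of_real (g x) = x" for x
  proof -
    obtain r where r: "x = of_real r" using True Reals_cases by blast
    then have "g x = r" unfolding g_def by auto
    then show ?thesis using r by simp
  qed
  have g_eqI: "g x = r" if "x = of_real r" for x r
    using g[of x] that by (metis of_real_eq_iff)
  have ng: "\<bar>g x\<bar> = norm x" for x
    by (metis g norm_of_real)
  show ?thesis
  proof
    show "bounded_linear (\<lambda>x. of_real (g x) :: complex)"
    proof (rule bounded_linear_intro[where K = 1])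
      fix x y :: 'k and r :: real
      have "g (x + y) = g x + g y" by (rule g_eqI) (simp add: g)
      then show "complex_of_real (g (x + y)) = of_real (g x) + of_real (g y)" by simp
      have "g (r *\<^sub>R x) = r * g x" by (rule g_eqI) (simp add: g scaleR_conv_of_real)
      then show "complex_of_real (g (r *\<^sub>R x)) = r *\<^sub>R of_real (g x)" by (simp add: scaleR_conv_of_real)
      show "cmod (of_real (g x)) \<le> norm x * 1" by (simp add: ng)
    qed
    show "bounded_linear (\<lambda>z. of_real (Re z) :: 'k)"
      by (intro bounded_linear_compose[OF bounded_linear_of_real] bounded_linear_Re)
  qed (simp add: g)
next
  case False
  then obtain x :: 'k where x: "x \<notin> \<real>" by blast
  obtain a b where ab: "(x - of_real a) * (x - of_real a) = - of_real (b * b)"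
    using real_normed_field_quadratic[of x] by blast
  have b0: "b \<noteq> 0"
  proof
    assume "b = 0"
    then have "x = of_real a" using ab by simp
    then show False using x by simp
  qed
  \<comment> \<open>Any non-real element yields a square root of -1 by completing the square and
    rescaling.\<close>
  define j where "j = (x - of_real a) / of_real b"
  have jj: "j * j = -1"
    using ab b0 by (simp add: j_def field_simps)
  define \<psi> where "\<psi> = (\<lambda>z. of_real (Re z) + of_real (Im z) * j)"
  have bl: "bounded_linear \<psi>"
    unfolding \<psi>_def
    by (intro bounded_linear_add bounded_linear_compose[OF bounded_linear_of_real] bounded_linear_Re
        bounded_linear_compose[OF bounded_linear_mult_left] bounded_linear_Im)
  have surj: "\<exists>z. \<psi> z = y" for y
  proof -
    obtain c d where cd: "(y - of_real c) * (y - of_real c) = - of_real (d * d)"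
      using real_normed_field_quadratic[of y] by blast
    \<comment> \<open>\<open>y - of_real c\<close> and \<open>of_real d * j\<close> have the same
      square, so in a field they agree up to sign.\<close>
    have "(y - of_real c - of_real d * j) * (y - of_real c + of_real d * j)
        = (y - of_real c) * (y - of_real c) - of_real (d * d) * (j * j)"
      by (simp add: algebra_simps)
    also have "\<dots> = 0" unfolding cd jj by simp
    finally have "y - of_real c - of_real d * j = 0 \<or> y - of_real c + of_real d * j = 0"
      by simp
    then have "y = of_real c + of_real d * j \<or> y = of_real c + of_real (- d) * j"
    proof
      assume "y - of_real c - of_real d * j = 0"
      then have "y = 0 + (of_real c + of_real d * j)" by (metis diff_add_cancel diff_diff_eq)
      then show ?thesis by simp
    next
      assume "y - of_real c + of_real d * j = 0"
      then have "y - of_real c = of_real (- d) * j" by (simp add: eq_neg_iff_add_eq_0)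
      then have "y = of_real c + of_real (- d) * j" by (metis add.commute diff_add_cancel)
      then show ?thesis by simp
    qed
    then have "y = \<psi> (Complex c d) \<or> y = \<psi> (Complex c (- d))"
      unfolding \<psi>_def by simp
    then show ?thesis by auto
  qed
  have nj: "norm j = 1"
  proof -
    have "norm j * norm j = 1" using arg_cong[OF jj, of norm] by (simp add: norm_mult)
    then show ?thesis by (metis norm_ge_zero abs_of_nonneg real_sqrt_abs2 real_sqrt_one)
  qed
  have low: "cmod z \<le> norm (\<psi> z) * 2" for z
  proof -
    \<comment> \<open>The product with the conjugate is the squared modulus, so an upper bound for
      the second factor becomes a lower bound for the first.\<close>
    have "\<psi> z * \<psi> (cnj z) = of_real (Re z * Re z) - of_real (Im z * Im z) * (j * j)"
      by (simp add: \<psi>_def algebra_simps)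
    also have "\<dots> = of_real ((cmod z)\<^sup>2)"
      unfolding jj cmod_power2 by (simp add: power2_eq_square)
    finally have "norm (\<psi> z) * norm (\<psi> (cnj z)) = (cmod z)\<^sup>2"
      by (metis norm_mult norm_of_real abs_power2)
    moreover have "norm (\<psi> (cnj z)) \<le> 2 * cmod z"
    proof -
      have "norm (\<psi> (cnj z)) \<le> norm (of_real (Re z) :: 'k) + norm (of_real (- Im z) * j)"
        unfolding \<psi>_def by (metis cnj.sel norm_triangle_ineq)
      also have "\<dots> = \<bar>Re z\<bar> + \<bar>Im z\<bar>" by (simp add: norm_mult nj)
      finally show ?thesis using abs_Re_le_cmod[of z] abs_Im_le_cmod[of z] by linarith
    qed
    ultimately have "cmod z * cmod z \<le> norm (\<psi> z) * 2 * cmod z"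
      by (metis mult.assoc mult_left_mono norm_ge_zero power2_eq_square)
    then show ?thesis
      by (cases "z = 0") auto
  qed
  define \<phi> where "\<phi> = (\<lambda>y. SOME z. \<psi> z = y)"
  have \<phi>: "\<psi> (\<phi> y) = y" for y unfolding \<phi>_def using surj[of y] by (rule someI_ex)
  interpret \<psi>: bounded_linear \<psi> by (rule bl)
  have inj: "z = z'" if "\<psi> z = \<psi> z'" for z z'
    using low[of "z - z'"] that by (simp add: \<psi>.diff)
  show ?thesis
  proof
    show "bounded_linear \<phi>"
    proof (rule bounded_linear_intro[where K = 2])
      show "\<phi> (x + y) = \<phi> x + \<phi> y" for x y by (rule inj) (simp add: \<phi> \<psi>.add)
      show "\<phi> (r *\<^sub>R x) = r *\<^sub>R \<phi> x" for r x by (rule inj) (simp add: \<phi> \<psi>.scaleR)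
      show "cmod (\<phi> x) \<le> norm x * 2" for x using low[of "\<phi> x"] by (simp add: \<phi>)
    qed
  qed (use bl \<phi> in auto)
qed

subsection \<open>Functions and sets modulo null sets\<close>

text \<open>The sum is formed in complex coordinates, where addition preserves measurability, and
  carried back by a continuous linear map.\<close>

lemma borel_measurable_field_add:
  fixes f g :: "'a \<Rightarrow> 'k::{real_normed_field,banach}"
  assumes "f \<in> borel_measurable M" "g \<in> borel_measurable M"
  shows "(\<lambda>x. f x + g x) \<in> borel_measurable M"
proof -
  obtain \<phi> :: "'k \<Rightarrow> complex" and \<psi> :: "complex \<Rightarrow> 'k"
    where bl: "bounded_linear \<phi>" "bounded_linear \<psi>" and inv: "\<And>x. \<psi> (\<phi> x) = x"
    using real_normed_field_coordinates by blast
  interpret \<psi>: bounded_linear \<psi> by fact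
  have m: "\<phi> \<in> borel_measurable borel" "\<psi> \<in> borel_measurable borel"
    by (intro borel_measurable_continuous_onI linear_continuous_on bl)+
  have "(\<lambda>x. \<psi> (\<phi> (f x) + \<phi> (g x))) \<in> borel_measurable M"
    by (intro measurable_compose[OF _ m(2)] borel_measurable_add
        measurable_compose[OF assms(1) m(1)] measurable_compose[OF assms(2) m(1)])
  then show ?thesis by (simp add: \<psi>.add inv)
qed

lemma borel_measurable_field_cmult:
  fixes f :: "'a \<Rightarrow> 'k::{real_normed_field,banach}"
  assumes "f \<in> borel_measurable M"
  shows "(\<lambda>x. c * f x) \<in> borel_measurable M"
  by (rule measurable_compose[OF assms borel_measurable_continuous_onI]) (intro continuous_intros)

lemma borel_measurable_norm_powr:
  assumes "f \<in> borel_measurable M"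
  shows "(\<lambda>x. norm (f x) powr (s::real)) \<in> borel_measurable M"
proof -
  have "(\<lambda>x. norm (f x)) \<in> borel_measurable M"
    by (rule measurable_compose[OF assms borel_measurable_continuous_onI]) (intro continuous_intros)
  then show ?thesis by measurable
qed

text \<open>Comparison with twice the larger norm covers exponents below 1 too, where the usual
  convexity argument fails.\<close>

lemma powr_norm_add_le:
  fixes a b :: "'k::real_normed_vector"
  assumes "s \<ge> 0"
  shows "norm (a + b) powr s \<le> 2 powr s * (norm a powr s + norm b powr s)"
proof -
  have "norm (a + b) powr s \<le> (2 * max (norm a) (norm b)) powr s"
    using norm_triangle_ineq[of a b] assms by (intro powr_mono2) auto
  also have "\<dots> = 2 powr s * (max (norm a) (norm b)) powr s"
    by (simp add: powr_mult)
  also have "(max (norm a) (norm b)) powr s \<le> norm a powr s + norm b powr s"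
    by (auto simp: max_def)
  finally show ?thesis by simp
qed

lemma Ls_add:
  fixes f g :: "'a \<Rightarrow> 'k::{real_normed_field,banach}"
  assumes "f \<in> Ls M s" "g \<in> Ls M s" "s \<ge> 0"
  shows "(\<lambda>x. f x + g x) \<in> Ls M s"
proof -
  have m: "(\<lambda>x. f x + g x) \<in> borel_measurable M"
    using assms by (intro borel_measurable_field_add) (auto simp: Ls_def)
  have "integrable M (\<lambda>x. norm (f x + g x) powr s)"
  proof (rule Bochner_Integration.integrable_bound)
    show "integrable M (\<lambda>x. 2 powr s * (norm (f x) powr s + norm (g x) powr s))"
      using assms by (auto simp: Ls_def)
    show "AE x in M. norm (norm (f x + g x) powr s) \<le> norm (2 powr s * (norm (f x) powr s + norm (g x) powr s))"
      using powr_norm_add_le[OF assms(3)] by (intro AE_I2) (simp add: abs_of_nonneg)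
  qed (rule borel_measurable_norm_powr[OF m])
  then show ?thesis using m by (simp add: Ls_def)
qed

lemma Ls_cmult:
  fixes f :: "'a \<Rightarrow> 'k::{real_normed_field,banach}"
  assumes "f \<in> Ls M s"
  shows "(\<lambda>x. c * f x) \<in> Ls M s"
  using assms borel_measurable_field_cmult[of f M c]
  by (auto simp: Ls_def norm_mult powr_mult)

lemma Ls_zero: "(\<lambda>x. 0) \<in> Ls M s"
  by (simp add: Ls_def)

lemma Ls_diff:
  fixes f g :: "'a \<Rightarrow> 'k::{real_normed_field,banach}"
  assumes "f \<in> Ls M s" "g \<in> Ls M s" "s \<ge> 0"
  shows "(\<lambda>x. f x - g x) \<in> Ls M s"
  using Ls_add[OF assms(1) Ls_cmult[OF assms(2), of "-1"] assms(3)] by simp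

text \<open>The p-th powers of the differences tend to 0 in mean, and convergence in mean gives an
  almost everywhere convergent subsequence.\<close>

lemma Lp_dist_AE_subseq:
  fixes f :: "'a \<Rightarrow> 'k::{real_normed_field,banach}"
  assumes f: "f \<in> Ls M p" and p: "p > 0" and S: "S \<subseteq> Ls M p"
    and close: "\<And>e. e > 0 \<Longrightarrow> \<exists>g\<in>S. Lp_dist M p f g < e"
  obtains g where "\<And>n::nat. g n \<in> S" "AE x in M. (\<lambda>n. g n x) \<longlonglongrightarrow> f x"
proof -
  \<comment> \<open>The radius is a p-th root, so that the integral of the p-th power falls below
    \<open>1 / real (Suc n)\<close>.\<close>
  have "\<forall>n. \<exists>g\<in>S. Lp_dist M p f g < (1 / real (Suc n)) powr (1 / p)"
    using close by (simp add: powr_gt_zero)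
  then obtain g where g: "\<And>n. g n \<in> S" "\<And>n. Lp_dist M p f (g n) < (1 / real (Suc n)) powr (1 / p)"
    by metis
  define u where "u = (\<lambda>n x. norm (f x - g n x) powr p)"
  have int: "integrable M (u n)" for n
    using Ls_diff[OF f, of "g n"] g(1)[of n] S p by (auto simp: Ls_def u_def)
  have small: "(\<integral>x. norm (u n x) \<partial>M) \<le> 1 / real (Suc n)" for n
  proof (rule ccontr)
    assume "\<not> ?thesis"
    then have "1 / real (Suc n) \<le> (\<integral>x. u n x \<partial>M)" by (simp add: u_def)
    then have "(1 / real (Suc n)) powr (1 / p) \<le> (\<integral>x. u n x \<partial>M) powr (1 / p)"
      using p by (intro powr_mono2) auto
    then show False using g(2)[of n] by (simp add: Lp_dist_def u_def)
  qed
  have "(\<lambda>n. \<integral>x. norm (u n x) \<partial>M) \<longlonglongrightarrow> 0"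
  proof (rule tendsto_sandwich[OF _ _ tendsto_const LIMSEQ_inverse_real_of_nat])
    show "\<forall>\<^sub>F n in sequentially. 0 \<le> (\<integral>x. norm (u n x) \<partial>M)" by (simp add: integral_nonneg)
    show "\<forall>\<^sub>F n in sequentially. (\<integral>x. norm (u n x) \<partial>M) \<le> inverse (real (Suc n))"
      using small by (simp add: inverse_eq_divide)
  qed
  then obtain r where r: "strict_mono r" "AE x in M. (\<lambda>n. u (r n) x) \<longlonglongrightarrow> 0"
    using tendsto_L1_AE_subseq[of M u] int by blast
  show ?thesis
  proof (rule that[of "\<lambda>n. g (r n)"])
    show "g (r n) \<in> S" for n by (rule g)
    show "AE x in M. (\<lambda>n. g (r n) x) \<longlonglongrightarrow> f x"
      using r(2)
    proof eventually_elim
      case (elim x)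
      have "(\<lambda>n. u (r n) x powr (1 / p)) \<longlonglongrightarrow> 0 powr (1 / p)"
        by (rule tendsto_powr2[OF elim tendsto_const]) (use p in \<open>auto simp: u_def\<close>)
      then have "(\<lambda>n. norm (f x - g (r n) x)) \<longlonglongrightarrow> 0"
        using p by (simp add: u_def powr_powr)
      then have "(\<lambda>n. norm (g (r n) x - f x)) \<longlonglongrightarrow> 0"
        by (simp add: norm_minus_commute)
      then show ?case using LIM_zero_cancel tendsto_norm_zero_iff by blast
    qed
  qed
qed

section \<open>Sets of finite measure and their classes\<close>

lemma fin_setsD: "A \<in> fin_sets M \<Longrightarrow> A \<in> sets M" "A \<in> fin_sets M \<Longrightarrow> emeasure M A < \<infinity>"
  by (auto simp: fin_sets_def)

lemma fin_sets_subset: "A \<in> fin_sets M \<Longrightarrow> B \<in> sets M \<Longrightarrow> B \<subseteq> A \<Longrightarrow> B \<in> fin_sets M"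
  unfolding fin_sets_def using emeasure_mono[of B A M] by (auto intro: order.strict_trans1)

lemma null_iff_AE_not_mem:
  assumes "A \<in> sets M"
  shows "emeasure M A = 0 \<longleftrightarrow> (AE x in M. x \<notin> A)"
  using AE_iff_null_sets[OF assms] assms by (auto simp: null_sets_def)

lemma ae_sim_iff:
  "(A, B) \<in> ae_sim M \<longleftrightarrow> A \<in> fin_sets M \<and> B \<in> fin_sets M \<and> (AE x in M. x \<in> A \<longleftrightarrow> x \<in> B)"
proof -
  have "emeasure M ((A - B) \<union> (B - A)) = 0 \<longleftrightarrow> (AE x in M. x \<in> A \<longleftrightarrow> x \<in> B)"
    if "A \<in> fin_sets M" "B \<in> fin_sets M"
  proof -
    have "(x \<notin> (A - B) \<union> (B - A)) = (x \<in> A \<longleftrightarrow> x \<in> B)" for x by auto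
    moreover have "(A - B) \<union> (B - A) \<in> sets M" using that fin_setsD(1) by auto
    ultimately show ?thesis using null_iff_AE_not_mem[of "(A - B) \<union> (B - A)" M] by presburger
  qed
  then show ?thesis unfolding ae_sim_def by blast
qed

lemma ae_class_eq_iff:
  assumes "A \<in> fin_sets M" "B \<in> fin_sets M"
  shows "ae_sim M `` {A} = ae_sim M `` {B} \<longleftrightarrow> (AE x in M. x \<in> A \<longleftrightarrow> x \<in> B)"
proof
  assume "ae_sim M `` {A} = ae_sim M `` {B}"
  moreover have "(B, B) \<in> ae_sim M" using assms by (simp add: ae_sim_iff)
  ultimately have "(A, B) \<in> ae_sim M" by blast
  then show "AE x in M. x \<in> A \<longleftrightarrow> x \<in> B" by (simp add: ae_sim_iff)
next
  assume ae: "AE x in M. x \<in> A \<longleftrightarrow> x \<in> B"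
  have "(A, C) \<in> ae_sim M \<longleftrightarrow> (B, C) \<in> ae_sim M" for C
  proof -
    have "(AE x in M. x \<in> A \<longleftrightarrow> x \<in> C) \<longleftrightarrow> (AE x in M. x \<in> B \<longleftrightarrow> x \<in> C)"
    proof
      assume "AE x in M. x \<in> A \<longleftrightarrow> x \<in> C"
      with ae show "AE x in M. x \<in> B \<longleftrightarrow> x \<in> C" by eventually_elim simp
    next
      assume "AE x in M. x \<in> B \<longleftrightarrow> x \<in> C"
      with ae show "AE x in M. x \<in> A \<longleftrightarrow> x \<in> C" by eventually_elim simp
    qed
    then show ?thesis using assms by (simp add: ae_sim_iff)
  qed
  then show "ae_sim M `` {A} = ae_sim M `` {B}" by auto
qed

lemma ent_classes_eq: "ent_classes M = (\<lambda>A. ae_sim M `` {A}) ` fin_sets M"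
  by (auto simp: ent_classes_def quotient_def)

text \<open>Markov's inequality, since the values in \<open>U\<close> stay away from 0.\<close>

lemma Ls_superlevel_fin:
  fixes f :: "'a \<Rightarrow> 'k::{real_normed_field,banach}"
  assumes f: "f \<in> Ls M s" and s: "s > 0" and U: "U \<in> sets borel" and \<delta>: "\<delta> > 0"
    and away: "\<And>y. y \<in> U \<Longrightarrow> \<delta> \<le> norm y"
  shows "f -` U \<inter> space M \<in> fin_sets M"
proof -
  have fm: "f \<in> borel_measurable M" and int: "integrable M (\<lambda>x. norm (f x) powr s)"
    using f by (auto simp: Ls_def)
  have sets: "f -` U \<inter> space M \<in> sets M" using measurable_sets[OF fm U] .
  have big: "{x \<in> space M. \<delta> powr s \<le> norm (f x) powr s} \<in> sets M"
    using borel_measurable_norm_powr[OF fm, of s] by measurable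
  have "f -` U \<inter> space M \<subseteq> {x \<in> space M. \<delta> powr s \<le> norm (f x) powr s}"
    using away \<delta> s by (auto intro!: powr_mono2)
  moreover have "emeasure M {x \<in> space M. \<delta> powr s \<le> norm (f x) powr s} < \<infinity>"
    using integral_Markov_inequality[OF int, of "\<delta> powr s"] \<delta> by (auto intro: order.strict_trans1)
  ultimately show ?thesis
    unfolding fin_sets_def using sets emeasure_mono[OF _ big] by (auto intro: order.strict_trans1)
qed

text \<open>The sets are half planes in complex coordinates, bounded by positive rational
  thresholds. Positivity keeps them away from 0, so their preimages under functions in
  \<open>Ls\<close> have finite measure; countably many suffice because the thresholds are
  rational.\<close>

lemma separating_sets:
  obtains U :: "nat \<Rightarrow> 'k::{real_normed_field,banach} set" and \<delta> :: "nat \<Rightarrow> real"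
  where "\<And>n. U n \<in> sets borel" "\<And>n. \<delta> n > 0" "\<And>n y. y \<in> U n \<Longrightarrow> \<delta> n \<le> norm y"
    "\<And>x y. x \<noteq> y \<Longrightarrow> \<exists>n. (x \<in> U n) \<noteq> (y \<in> U n)"
proof -
  obtain \<phi> :: "'k \<Rightarrow> complex" and \<psi> :: "complex \<Rightarrow> 'k"
    where bl: "bounded_linear \<phi>" "bounded_linear \<psi>" and inv: "\<And>x. \<psi> (\<phi> x) = x"
    using real_normed_field_coordinates by blast
  obtain K where K: "K > 0" "\<And>x. cmod (\<phi> x) \<le> norm x * K"
    using bounded_linear.pos_bounded[OF bl(1)] by blast
  \<comment> \<open>Both coordinates occur with both signs, as the positive thresholds see only
    positive values.\<close>
  define lin :: "nat \<Rightarrow> complex \<Rightarrow> real" where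
    "lin = (\<lambda>i z. if i = 0 then Re z else if i = 1 then - Re z else if i = 2 then Im z else - Im z)"
  have lin_le: "lin i z \<le> cmod z" for i z
    using abs_Re_le_cmod[of z] abs_Im_le_cmod[of z] by (auto simp: lin_def)
  define V where "V = (\<lambda>(i, k::nat, l::nat). {y. lin i (\<phi> y) > (real k + 1) / (real l + 1)})"
  define d where "d = (\<lambda>(i::nat, k::nat, l::nat). (real k + 1) / (real l + 1) / K)"
  have cont\<phi>: "continuous_on UNIV \<phi>" by (intro linear_continuous_on bl)
  have "V t \<in> sets borel" for t
  proof -
    obtain i k l where t: "t = (i, k, l)" by (cases t) auto
    have "continuous_on UNIV (\<lambda>y. lin i (\<phi> y))"
      unfolding lin_def by (cases "i = 0"; cases "i = 1"; cases "i = 2"; simp; intro continuous_intros cont\<phi>)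
    then have "open (V t)" unfolding V_def t by (auto intro!: open_Collect_less continuous_intros)
    then show ?thesis by simp
  qed
  moreover have "d t > 0" for t using K(1) by (cases t) (auto simp: d_def)
  moreover have "d t \<le> norm y" if "y \<in> V t" for t y
  proof -
    obtain i k l where t: "t = (i, k, l)" by (cases t) auto
    have "(real k + 1) / (real l + 1) \<le> norm y * K"
      using that lin_le[of i "\<phi> y"] K(2)[of y] by (auto simp: V_def t)
    then show ?thesis using K(1) by (simp only: d_def t prod.case pos_divide_le_eq)
  qed
  moreover have "\<exists>t. (x \<in> V t) \<noteq> (y \<in> V t)" if "x \<noteq> y" for x y
  proof -
    \<comment> \<open>The fractions \<open>(real k + 1) / (real l + 1)\<close> run through all
      positive rationals.\<close>
    have pos_rat: "\<exists>k l. a \<le> (real k + 1) / (real l + 1) \<and> (real k + 1) / (real l + 1) < b" if "a < b" "0 < b" for a b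
    proof -
      have "max 0 a < b" using that by simp
      then obtain q :: rat where q: "max 0 a < of_rat q" "of_rat q < b" using of_rat_dense by blast
      then have q0: "q > 0" by simp
      obtain m n where mn: "quotient_of q = (m, n)" by fastforce
      have "n > 0" using quotient_of_denom_pos[OF mn] .
      have qmn: "q = of_int m / of_int n" using quotient_of_div[OF mn] .
      with q0 \<open>n > 0\<close> have "m > 0" by (simp add: zero_less_divide_iff)
      have "real_of_rat q = (real (nat (m - 1)) + 1) / (real (nat (n - 1)) + 1)"
        using \<open>m > 0\<close> \<open>n > 0\<close> by (simp add: qmn of_rat_divide)
      then show ?thesis using q by (metis less_eq_real_def max.strict_boundedE)
    qed
    have sep: "\<exists>t. (x \<in> V t) \<noteq> (y \<in> V t)" if less: "lin i (\<phi> y) < lin i (\<phi> x)" "0 < lin i (\<phi> x)" for x y i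
    proof -
      obtain k l where "lin i (\<phi> y) \<le> (real k + 1) / (real l + 1)" "(real k + 1) / (real l + 1) < lin i (\<phi> x)"
        using pos_rat[OF less] by blast
      then have "x \<in> V (i, k, l)" "y \<notin> V (i, k, l)" by (auto simp: V_def)
      then show ?thesis by blast
    qed
    \<comment> \<open>If the larger of the two values is not positive, the opposite functional is
      positive at the other point and separates there.\<close>
    have sep_neg: "\<exists>t. (x \<in> V t) \<noteq> (y \<in> V t)" if "lin i (\<phi> y) < lin i (\<phi> x)" "lin j = (\<lambda>z. - lin i z)" for x y i j
    proof (cases "0 < lin i (\<phi> x)")
      case False
      then have "lin j (\<phi> x) < lin j (\<phi> y)" "0 < lin j (\<phi> y)" using that by auto
      then obtain t where "(y \<in> V t) \<noteq> (x \<in> V t)" using sep[of j x y] by blast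
      then show ?thesis by blast
    qed (use sep that in blast)
    have neg: "lin 1 = (\<lambda>z. - lin 0 z)" "lin 3 = (\<lambda>z. - lin 2 z)" by (auto simp: lin_def)
    have "\<phi> x \<noteq> \<phi> y" using that inv by metis
    then consider "lin 0 (\<phi> x) \<noteq> lin 0 (\<phi> y)" | "lin 2 (\<phi> x) \<noteq> lin 2 (\<phi> y)"
      by (auto simp: lin_def complex_eq_iff)
    then show ?thesis
    proof cases
      case 1
      then have "lin 0 (\<phi> y) < lin 0 (\<phi> x) \<or> lin 0 (\<phi> x) < lin 0 (\<phi> y)" by linarith
      then show ?thesis using sep_neg[OF _ neg(1), of x y] sep_neg[OF _ neg(1), of y x] by blast
    next
      case 2
      then have "lin 2 (\<phi> y) < lin 2 (\<phi> x) \<or> lin 2 (\<phi> x) < lin 2 (\<phi> y)" by linarith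
      then show ?thesis using sep_neg[OF _ neg(2), of x y] sep_neg[OF _ neg(2), of y x] by blast
    qed
  qed
  ultimately have V: "\<And>t. V t \<in> sets borel" "\<And>t. d t > 0" "\<And>t y. y \<in> V t \<Longrightarrow> d t \<le> norm y"
    "\<And>x y. x \<noteq> y \<Longrightarrow> \<exists>t. (x \<in> V t) \<noteq> (y \<in> V t)" by blast+
  show ?thesis
  proof (rule that[of "\<lambda>n. V (from_nat n)" "\<lambda>n. d (from_nat n)"])
    fix x y :: 'k assume "x \<noteq> y"
    then obtain t where "(x \<in> V t) \<noteq> (y \<in> V t)" using V(4) by blast
    then show "\<exists>n. (x \<in> V (from_nat n)) \<noteq> (y \<in> V (from_nat n))"
      by (intro exI[of _ "to_nat t"]) simp
  qed (use V in auto)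
qed

section \<open>Independence and Hamel bases modulo null sets\<close>

lemma lin_indep_aeD:
  assumes "lin_indep_ae M C" "finite F" "F \<subseteq> C" "AE x in M. (\<Sum>b\<in>F. c b * b x) = 0" "b \<in> F"
  shows "c b = 0"
  using assms unfolding lin_indep_ae_def by blast

text \<open>A function is recorded by the classes of its preimages of the separating sets. Equal
  records force equality almost everywhere, and for distinct members of \<open>C\<close> this would
  be the relation f - g = 0.\<close>

lemma lin_indep_lepoll_seqs_ent:
  fixes C :: "('a \<Rightarrow> 'k::{real_normed_field,banach}) set"
  assumes C: "C \<subseteq> Ls M s" "lin_indep_ae M C" and s: "s > 0"
  shows "C \<lesssim> seqs (ent_classes M)"
proof -
  obtain U :: "nat \<Rightarrow> 'k set" and \<delta> :: "nat \<Rightarrow> real"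
    where U: "\<And>n. U n \<in> sets borel" "\<And>n. \<delta> n > 0" "\<And>n y. y \<in> U n \<Longrightarrow> \<delta> n \<le> norm y"
      "\<And>x y. x \<noteq> y \<Longrightarrow> \<exists>n. (x \<in> U n) \<noteq> (y \<in> U n)"
    using separating_sets by blast
  have fin: "f -` U n \<inter> space M \<in> fin_sets M" if "f \<in> C" for f n
    using that C(1) s U by (intro Ls_superlevel_fin[of f M s "U n" "\<delta> n"]) auto
  show ?thesis unfolding lepoll_def
  proof (intro exI conjI)
    show "inj_on (\<lambda>f n. ae_sim M `` {f -` U n \<inter> space M}) C"
    proof (rule inj_onI, rule ccontr)
      fix f g assume fg: "f \<in> C" "g \<in> C" "f \<noteq> g"
        and e: "(\<lambda>n. ae_sim M `` {f -` U n \<inter> space M}) = (\<lambda>n. ae_sim M `` {g -` U n \<inter> space M})"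
      have "AE x in M. x \<in> f -` U n \<inter> space M \<longleftrightarrow> x \<in> g -` U n \<inter> space M" for n
        using fun_cong[OF e, of n] ae_class_eq_iff fin fg by blast
      then have "AE x in M. \<forall>n. x \<in> f -` U n \<inter> space M \<longleftrightarrow> x \<in> g -` U n \<inter> space M"
        by (simp add: AE_all_countable)
      then have "AE x in M. f x = g x"
        using AE_space by eventually_elim (use U(4) in blast)
      then have "AE x in M. (\<Sum>b\<in>{f, g}. (if b = f then 1 else - 1) * b x) = 0"
        by eventually_elim (use fg in auto)
      then have "(if f = f then 1 else - 1 :: 'k) = 0"
        using fg by (intro lin_indep_aeD[OF C(2), of "{f, g}" "\<lambda>b. if b = f then 1 else - 1" f]) auto
      then show False by simp
    qed
    show "(\<lambda>f n. ae_sim M `` {f -` U n \<inter> space M}) ` C \<subseteq> seqs (ent_classes M)"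
      using fin by (auto simp: seqs_def ent_classes_eq)
  qed
qed

text \<open>Zorn's lemma applies because a linear relation involves finitely many members, which lie
  in one member of the chain. Maximality then gives spanning.\<close>

lemma hamel_basis_extend:
  fixes I S :: "('a \<Rightarrow> 'k::{real_normed_field,banach}) set"
  assumes "I \<subseteq> S" "lin_indep_ae M I"
  obtains B where "I \<subseteq> B" "hamel_basis_ae M B S"
proof -
  define \<A> where "\<A> = {B. I \<subseteq> B \<and> B \<subseteq> S \<and> lin_indep_ae M B}"
  have "\<exists>B\<in>\<A>. \<forall>X\<in>\<A>. B \<subseteq> X \<longrightarrow> X = B"
  proof (rule subset_Zorn_nonempty)
    show "\<A> \<noteq> {}" using assms by (auto simp: \<A>_def)
    fix \<C> assume \<C>: "\<C> \<noteq> {}" "subset.chain \<A> \<C>"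
    have "lin_indep_ae M (\<Union>\<C>)"
      unfolding lin_indep_ae_def
    proof (intro allI impI)
      fix F c assume F: "finite F" "F \<subseteq> \<Union>\<C>" "AE x in M. (\<Sum>b\<in>F. c b * b x) = 0"
      obtain B where "B \<in> \<C>" "F \<subseteq> B"
        using finite_subset_Union_chain[OF F(1,2) \<C>] by blast
      moreover have "lin_indep_ae M B" using \<open>B \<in> \<C>\<close> \<C> by (auto simp: subset.chain_def \<A>_def)
      ultimately show "\<forall>b\<in>F. c b = 0" using F unfolding lin_indep_ae_def by blast
    qed
    then show "\<Union>\<C> \<in> \<A>" using \<C> by (auto simp: subset.chain_def \<A>_def)
  qed
  then obtain B where B: "B \<in> \<A>" "\<And>X. X \<in> \<A> \<Longrightarrow> B \<subseteq> X \<Longrightarrow> X = B" by blast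
  have "spans_ae M B S"
    unfolding spans_ae_def
  proof
    fix f assume f: "f \<in> S"
    show "\<exists>F c. finite F \<and> F \<subseteq> B \<and> (AE x in M. f x = (\<Sum>b\<in>F. c b * b x))"
    proof (cases "f \<in> B")
      case True
      then show ?thesis by (intro exI[of _ "{f}"] exI[of _ "\<lambda>_. 1"]) auto
    next
      case False
      have "insert f B \<notin> \<A>" using B(2)[of "insert f B"] False by auto
      then have "\<not> lin_indep_ae M (insert f B)" using B(1) f by (auto simp: \<A>_def)
      then obtain F c where F: "finite F" "F \<subseteq> insert f B" "AE x in M. (\<Sum>b\<in>F. c b * b x) = 0"
        "\<exists>b\<in>F. c b \<noteq> 0"
        unfolding lin_indep_ae_def by blast
      define G where "G = F - {f}"
      have G: "finite G" "G \<subseteq> B" using F by (auto simp: G_def)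
      \<comment> \<open>Otherwise the relation would live on \<open>B\<close> alone. With a nonzero
        coefficient it can be solved for \<open>f\<close>.\<close>
      have "f \<in> F \<and> c f \<noteq> 0"
      proof (rule ccontr)
        assume n: "\<not> ?thesis"
        have "(\<Sum>b\<in>G. c b * b x) = (\<Sum>b\<in>F. c b * b x)" for x
          using n F(1) unfolding G_def by (intro sum.mono_neutral_left) auto
        then have "AE x in M. (\<Sum>b\<in>G. c b * b x) = 0" using F(3) by simp
        then have "\<forall>b\<in>G. c b = 0" using B(1) G unfolding \<A>_def lin_indep_ae_def by blast
        then show False using F(4) n by (auto simp: G_def)
      qed
      then have fF: "f \<in> F" "c f \<noteq> 0" by auto
      have "AE x in M. f x = (\<Sum>b\<in>G. (- c b / c f) * b x)"
        using F(3)
      proof eventually_elim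
        case (elim x)
        have "c f * f x = - (\<Sum>b\<in>G. c b * b x)"
          using elim F(1) fF by (simp add: G_def sum.remove[of F f] eq_neg_iff_add_eq_0)
        then have "f x = - (\<Sum>b\<in>G. c b * b x) / c f" using fF by (simp add: field_simps)
        then show ?case by (simp add: sum_divide_distrib sum_negf)
      qed
      then show ?thesis using G by (intro exI[of _ G] exI[of _ "\<lambda>b. - c b / c f"] conjI)
    qed
  qed
  then have "hamel_basis_ae M B S" using B(1) by (auto simp: hamel_basis_ae_def \<A>_def)
  then show ?thesis using B(1) by (intro that) (auto simp: \<A>_def)
qed

subsection \<open>Spikes with almost disjoint supports\<close>

text \<open>\<open>u j\<close> is the p-th power of the modulus of the spike on \<open>D j\<close>.
  With s = q/p, \<open>u_powr\<close> says that the spike is in no L_q with q < p; the common bound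
  \<open>W\<close> makes weighted sums of infinitely many spikes converge.\<close>

locale spike_family =
  fixes M :: "'a measure" and p :: real and J :: "'j set"
    and D :: "'j \<Rightarrow> 'a set" and u :: "'j \<Rightarrow> 'a \<Rightarrow> real" and W :: real
  assumes p: "p > 1"
    and inf: "infinite J"
    and D_sets: "j \<in> J \<Longrightarrow> D j \<in> sets M"
    and D_disj: "i \<in> J \<Longrightarrow> j \<in> J \<Longrightarrow> i \<noteq> j \<Longrightarrow> AE x in M. \<not> (x \<in> D i \<and> x \<in> D j)"
    and u_int: "j \<in> J \<Longrightarrow> integrable M (u j)"
    and u_nonneg: "j \<in> J \<Longrightarrow> 0 \<le> u j x"
    and u_pos: "j \<in> J \<Longrightarrow> x \<in> D j \<Longrightarrow> 0 < u j x"
    and u_zero: "j \<in> J \<Longrightarrow> x \<notin> D j \<Longrightarrow> u j x = 0"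
    and u_bound: "j \<in> J \<Longrightarrow> (\<integral>x. u j x \<partial>M) \<le> W"
    and u_powr: "j \<in> J \<Longrightarrow> 0 < s \<Longrightarrow> s < 1 \<Longrightarrow> \<not> integrable M (\<lambda>x. u j x powr s)"
begin

text \<open>Vanishing off the supports is tested on sets of finite measure, because the union of
  uncountably many \<open>D j\<close> need not be measurable.\<close>

definition spike_space :: "('a \<Rightarrow> 'k::{real_normed_field,banach}) set" where
  "spike_space = {f \<in> Ls M p.
     (\<forall>j\<in>J. \<exists>a. AE x in M. x \<in> D j \<longrightarrow> f x = a * of_real (u j x powr (1 / p))) \<and>
     (\<forall>E\<in>fin_sets M. (\<forall>j\<in>J. AE x in M. \<not> (x \<in> E \<and> x \<in> D j)) \<longrightarrow> (AE x in M. x \<in> E \<longrightarrow> f x = 0))}"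

lemma u_powr_measurable: "j \<in> J \<Longrightarrow> (\<lambda>x. u j x powr s) \<in> borel_measurable M"
  using borel_measurable_integrable[OF u_int] by measurable

text \<open>On a null support, \<open>u j\<close> would vanish almost everywhere and have an
  integrable square root.\<close>

lemma D_not_null: "j \<in> J \<Longrightarrow> \<not> (AE x in M. x \<notin> D j)"
proof
  assume j: "j \<in> J" and "AE x in M. x \<notin> D j"
  then have "AE x in M. u j x powr (1 / 2) = 0"
    by (auto elim!: eventually_mono simp: u_zero)
  moreover note u_powr_measurable[OF j, of "1 / 2"]
  ultimately have "integrable M (\<lambda>x. u j x powr (1 / 2))"
    using integrable_cong_AE[of "\<lambda>x. u j x powr (1 / 2)" M "\<lambda>x. 0"] by auto
  then show False using u_powr[OF j, of "1 / 2"] by simp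
qed

lemma ex_point:
  assumes "j \<in> J" "AE x in M. P x"
  obtains x where "x \<in> D j" "P x"
proof -
  have "\<exists>x. x \<in> D j \<and> P x"
  proof (rule ccontr)
    assume "\<not> ?thesis"
    then have "AE x in M. x \<notin> D j" using assms(2) by (auto elim!: eventually_mono)
    then show False using D_not_null[OF assms(1)] by blast
  qed
  then show ?thesis using that by blast
qed

lemma spike_spaceD:
  assumes "f \<in> spike_space"
  shows "f \<in> Ls M p"
    "j \<in> J \<Longrightarrow> \<exists>a. AE x in M. x \<in> D j \<longrightarrow> f x = a * of_real (u j x powr (1 / p))"
    "E \<in> fin_sets M \<Longrightarrow> (\<And>j. j \<in> J \<Longrightarrow> AE x in M. \<not> (x \<in> E \<and> x \<in> D j)) \<Longrightarrow> AE x in M. x \<in> E \<longrightarrow> f x = 0"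
  using assms unfolding spike_space_def by blast+

lemma spike_spaceI:
  assumes "f \<in> Ls M p"
    "\<And>j. j \<in> J \<Longrightarrow> \<exists>a. AE x in M. x \<in> D j \<longrightarrow> f x = a * of_real (u j x powr (1 / p))"
    "\<And>E. E \<in> fin_sets M \<Longrightarrow> (\<And>j. j \<in> J \<Longrightarrow> AE x in M. \<not> (x \<in> E \<and> x \<in> D j)) \<Longrightarrow> AE x in M. x \<in> E \<longrightarrow> f x = 0"
  shows "f \<in> spike_space"
  using assms unfolding spike_space_def by blast

text \<open>On each \<open>D j\<close> a single point already determines the coefficients, so these
  converge and the limit is again a multiple of the spike.\<close>

lemma spike_space_limit:
  fixes f :: "'a \<Rightarrow> 'k::{real_normed_field,banach}"
  assumes f: "f \<in> Ls M p" and g: "\<And>n::nat. g n \<in> spike_space"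
    and lim: "AE x in M. (\<lambda>n. g n x) \<longlonglongrightarrow> f x"
  shows "f \<in> spike_space"
proof (rule spike_spaceI[OF f])
  fix j assume j: "j \<in> J"
  define h where "h = (\<lambda>x. of_real (u j x powr (1 / p)) :: 'k)"
  have "\<forall>n. \<exists>a. AE x in M. x \<in> D j \<longrightarrow> g n x = a * h x"
    using spike_spaceD(2)[OF g j] unfolding h_def by blast
  then obtain a where "\<And>n. AE x in M. x \<in> D j \<longrightarrow> g n x = a n * h x" by metis
  then have "AE x in M. \<forall>n. x \<in> D j \<longrightarrow> g n x = a n * h x"
    unfolding AE_all_countable by blast
  then have ae: "AE x in M. (\<forall>n. x \<in> D j \<longrightarrow> g n x = a n * h x) \<and> (\<lambda>n. g n x) \<longlonglongrightarrow> f x"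
    using lim by eventually_elim auto
  \<comment> \<open>A point outside the countable union of exceptional null sets exists, since
    \<open>D j\<close> is not null.\<close>
  obtain x0 where x0: "x0 \<in> D j"
    and "(\<forall>n. x0 \<in> D j \<longrightarrow> g n x0 = a n * h x0) \<and> (\<lambda>n. g n x0) \<longlonglongrightarrow> f x0"
    by (rule ex_point[OF j ae])
  then have x0': "g n x0 = a n * h x0" "(\<lambda>n. g n x0) \<longlonglongrightarrow> f x0" for n by auto
  have h0: "h x0 \<noteq> 0" using u_pos[OF j x0] by (simp add: h_def)
  define b where "b = f x0 / h x0"
  have "(\<lambda>n. g n x0 / h x0) \<longlonglongrightarrow> b" unfolding b_def by (intro tendsto_divide x0'(2) tendsto_const h0)
  then have b: "a \<longlonglongrightarrow> b" using h0 by (simp add: x0'(1))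
  have "AE x in M. x \<in> D j \<longrightarrow> f x = b * h x"
    using ae
  proof eventually_elim
    case (elim x)
    show ?case
    proof
      assume "x \<in> D j"
      then have "(\<lambda>n. g n x) \<longlonglongrightarrow> b * h x" using elim by (auto intro!: tendsto_mult_right b)
      then show "f x = b * h x" using elim LIMSEQ_unique by blast
    qed
  qed
  then show "\<exists>a. AE x in M. x \<in> D j \<longrightarrow> f x = a * of_real (u j x powr (1 / p))"
    unfolding h_def by blast
next
  fix E assume E: "E \<in> fin_sets M" "\<And>j. j \<in> J \<Longrightarrow> AE x in M. \<not> (x \<in> E \<and> x \<in> D j)"
  have "AE x in M. x \<in> E \<longrightarrow> g n x = 0" for n by (rule spike_spaceD(3)[OF g E])
  then have "AE x in M. \<forall>n. x \<in> E \<longrightarrow> g n x = 0" unfolding AE_all_countable by blast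
  then show "AE x in M. x \<in> E \<longrightarrow> f x = 0"
    using lim
  proof eventually_elim
    case (elim x)
    then show ?case by (auto intro: LIMSEQ_unique)
  qed
qed

lemma closed_subspace_spike_space:
  "closed_subspace_Lp M p (spike_space :: ('a \<Rightarrow> 'k::{real_normed_field,banach}) set)"
  unfolding closed_subspace_Lp_def
proof (intro conjI ballI allI impI)
  show "spike_space \<subseteq> Ls M p" using spike_spaceD(1) by blast
  show "(\<lambda>x. 0) \<in> spike_space"
    by (rule spike_spaceI) (auto intro!: Ls_zero exI[of _ 0])
next
  fix f g :: "'a \<Rightarrow> 'k" assume f: "f \<in> spike_space" and g: "g \<in> spike_space"
  show "(\<lambda>x. f x + g x) \<in> spike_space"
  proof (rule spike_spaceI)
    show "(\<lambda>x. f x + g x) \<in> Ls M p" using Ls_add f g spike_spaceD(1) p by fastforce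
    fix j assume j: "j \<in> J"
    obtain a where "AE x in M. x \<in> D j \<longrightarrow> f x = a * of_real (u j x powr (1 / p))"
      using spike_spaceD(2)[OF f j] by blast
    moreover obtain b where "AE x in M. x \<in> D j \<longrightarrow> g x = b * of_real (u j x powr (1 / p))"
      using spike_spaceD(2)[OF g j] by blast
    ultimately have "AE x in M. x \<in> D j \<longrightarrow> f x + g x = (a + b) * of_real (u j x powr (1 / p))"
      by eventually_elim (auto simp: distrib_right)
    then show "\<exists>a. AE x in M. x \<in> D j \<longrightarrow> f x + g x = a * of_real (u j x powr (1 / p))" by blast
  next
    fix E assume E: "E \<in> fin_sets M" "\<And>j. j \<in> J \<Longrightarrow> AE x in M. \<not> (x \<in> E \<and> x \<in> D j)"
    show "AE x in M. x \<in> E \<longrightarrow> f x + g x = 0"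
    proof -
      have "AE x in M. x \<in> E \<longrightarrow> f x = 0" by (rule spike_spaceD(3)[OF f E])
      moreover have "AE x in M. x \<in> E \<longrightarrow> g x = 0" by (rule spike_spaceD(3)[OF g E])
      ultimately show ?thesis by eventually_elim auto
    qed
  qed
next
  fix c and f :: "'a \<Rightarrow> 'k" assume f: "f \<in> spike_space"
  show "(\<lambda>x. c * f x) \<in> spike_space"
  proof (rule spike_spaceI)
    show "(\<lambda>x. c * f x) \<in> Ls M p" using Ls_cmult f spike_spaceD(1) by blast
    fix j assume j: "j \<in> J"
    obtain a where "AE x in M. x \<in> D j \<longrightarrow> f x = a * of_real (u j x powr (1 / p))"
      using spike_spaceD(2)[OF f j] by blast
    then have "AE x in M. x \<in> D j \<longrightarrow> c * f x = (c * a) * of_real (u j x powr (1 / p))"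
      by eventually_elim auto
    then show "\<exists>a. AE x in M. x \<in> D j \<longrightarrow> c * f x = a * of_real (u j x powr (1 / p))" by blast
  next
    fix E assume E: "E \<in> fin_sets M" "\<And>j. j \<in> J \<Longrightarrow> AE x in M. \<not> (x \<in> E \<and> x \<in> D j)"
    show "AE x in M. x \<in> E \<longrightarrow> c * f x = 0"
    proof -
      have "AE x in M. x \<in> E \<longrightarrow> f x = 0" by (rule spike_spaceD(3)[OF f E])
      then show ?thesis by eventually_elim auto
    qed
  qed
next
  fix f g :: "'a \<Rightarrow> 'k" assume f: "f \<in> spike_space" and g: "g \<in> Ls M p" and "AE x in M. f x = g x"
  \<comment> \<open>Saturation is the limit statement for a constant sequence.\<close>
  then show "g \<in> spike_space"
    by (intro spike_space_limit[OF g, of "\<lambda>_. f"]) (auto elim!: eventually_mono)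
next
  fix f :: "'a \<Rightarrow> 'k"
  assume f: "f \<in> Ls M p" and close: "\<forall>e>0. \<exists>g\<in>spike_space. Lp_dist M p f g < e"
  have sub: "(spike_space :: ('a \<Rightarrow> 'k) set) \<subseteq> Ls M p" using spike_spaceD(1) by blast
  have p0: "p > 0" using p by simp
  have close': "\<exists>g\<in>spike_space. Lp_dist M p f g < e" if "e > 0" for e using close that by blast
  have "\<exists>g. (\<forall>n::nat. g n \<in> spike_space) \<and> (AE x in M. (\<lambda>n. g n x) \<longlonglongrightarrow> f x)"
    by (rule Lp_dist_AE_subseq[OF f p0 sub close']) blast+
  then show "f \<in> spike_space" using spike_space_limit[OF f] by blast
qed

text \<open>A nonzero coefficient on some \<open>D j\<close> would make the power q/p of
  \<open>u j\<close> integrable. So \<open>f\<close> vanishes on every \<open>D j\<close>, and the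
  second condition in \<open>spike_space\<close> takes care of the rest.\<close>

lemma spike_space_not_Ls:
  fixes f :: "'a \<Rightarrow> 'k::{real_normed_field,banach}"
  assumes f: "f \<in> spike_space" and fq: "f \<in> Ls M q" and q: "1 \<le> q" "q < p"
  shows "AE x in M. f x = 0"
proof -
  have zero_on: "AE x in M. x \<in> D j \<longrightarrow> f x = 0" if j: "j \<in> J" for j
  proof -
    obtain a where a: "AE x in M. x \<in> D j \<longrightarrow> f x = a * of_real (u j x powr (1 / p))"
      using spike_spaceD(2)[OF f j] by blast
    have "a = 0"
    proof (rule ccontr)
      assume a0: "a \<noteq> 0"
      have "integrable M (\<lambda>x. u j x powr (q / p))"
      proof (rule Bochner_Integration.integrable_bound[OF _ u_powr_measurable[OF j]])
        show "integrable M (\<lambda>x. norm (f x) powr q / norm a powr q)"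
          using fq by (auto simp: Ls_def)
        show "AE x in M. norm (u j x powr (q / p)) \<le> norm (norm (f x) powr q / norm a powr q)"
          using a
        proof eventually_elim
          case (elim x)
          show ?case
          proof (cases "x \<in> D j")
            case True
            then have "norm (f x) = norm a * u j x powr (1 / p)"
              using elim by (simp add: norm_mult)
            then have "norm (f x) powr q = norm a powr q * u j x powr (q / p)"
              using p by (simp add: powr_mult powr_powr)
            then show ?thesis using a0 by simp
          qed (simp add: u_zero[OF j])
        qed
      qed
      then show False using u_powr[OF j, of "q / p"] q p by simp
    qed
    then show ?thesis using a by simp
  qed
  \<comment> \<open>These sets have finite measure and exhaust the set where \<open>f\<close> is
    nonzero, so the condition on sets of finite measure can be used.\<close>
  define E where "E = (\<lambda>n::nat. f -` {y. 1 / real (Suc n) \<le> norm y} \<inter> space M)"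
  have "AE x in M. x \<notin> E n" for n
  proof -
    have "closed {y::'k. 1 / real (Suc n) \<le> norm y}"
      by (intro closed_Collect_le continuous_intros)
    then have fin: "E n \<in> fin_sets M"
      unfolding E_def using spike_spaceD(1)[OF f] p
      by (intro Ls_superlevel_fin[of f M p _ "1 / real (Suc n)"]) auto
    have E0: "f x \<noteq> 0" if "x \<in> E n" for x using that by (auto simp: E_def)
    have "AE x in M. x \<in> E n \<longrightarrow> f x = 0"
    proof (rule spike_spaceD(3)[OF f fin])
      fix j assume "j \<in> J"
      from zero_on[OF this] show "AE x in M. \<not> (x \<in> E n \<and> x \<in> D j)"
        by eventually_elim (use E0 in auto)
    qed
    then show ?thesis by eventually_elim (use E0 in auto)
  qed
  then have "AE x in M. \<forall>n. x \<notin> E n" by (simp add: AE_all_countable)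
  then show ?thesis
    using AE_space
  proof eventually_elim
    case (elim x)
    show ?case
    proof (rule ccontr)
      assume "f x \<noteq> 0"
      then obtain n where "inverse (real (Suc n)) < norm (f x)"
        using reals_Archimedean[of "norm (f x)"] by auto
      then have "1 / real (Suc n) \<le> norm (f x)" by (simp only: inverse_eq_divide less_imp_le)
      then have "x \<in> E n" using elim(2) unfolding E_def by blast
      then show False using elim by blast
    qed
  qed
qed

section \<open>Independent functions indexed by the branches of a tree\<close>

definition encode :: "'j list \<Rightarrow> 'j" where
  "encode = (SOME e. inj_on e (lists J) \<and> e ` lists J \<subseteq> J)"

lemma encode: "inj_on encode (lists J)" "encode ` lists J \<subseteq> J"
proof -
  have "\<exists>e. inj_on e (lists J) \<and> e ` lists J \<subseteq> J" using lists_inject[OF inf] by metis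
  then have "inj_on encode (lists J) \<and> encode ` lists J \<subseteq> J" unfolding encode_def by (rule someI_ex)
  then show "inj_on encode (lists J)" "encode ` lists J \<subseteq> J" by auto
qed

text \<open>The nodes of a branch of the tree of finite sequences in \<open>J\<close>; two distinct branches
  share only finitely many nodes.\<close>
definition node :: "(nat \<Rightarrow> 'j) \<Rightarrow> nat \<Rightarrow> 'j" where
  "node t n = encode (map t [0..<n])"

lemma map_in_lists: "t \<in> seqs J \<Longrightarrow> map t [0..<n] \<in> lists J"
  by (auto simp: seqs_def)

lemma node_in: "t \<in> seqs J \<Longrightarrow> node t n \<in> J"
  using encode(2) map_in_lists unfolding node_def by blast

text \<open>A node codes a whole prefix, hence both its depth and all earlier entries of the
  branch.\<close>

lemma node_eqD:
  assumes "t \<in> seqs J" "t' \<in> seqs J" "node t n = node t' m"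
  shows "n = m" "i < n \<Longrightarrow> t i = t' i"
proof -
  have e: "map t [0..<n] = map t' [0..<m]"
    using inj_onD[OF encode(1)] assms map_in_lists unfolding node_def by blast
  then show nm: "n = m" using map_eq_imp_length_eq by fastforce
  show "t i = t' i" if "i < n" using e nm that by simp
qed

text \<open>The p-th power of the branch function, with values in \<open>ennreal\<close> so that the
  series exists at every point.\<close>

definition mass :: "(nat \<Rightarrow> 'j) \<Rightarrow> 'a \<Rightarrow> ennreal" where
  "mass t x = (\<Sum>n. ennreal ((1 / 2) ^ n * u (node t n) x))"

text \<open>\<open>enn2real\<close> sends an infinite mass to 0; this affects only a null set, as
  the mass has finite integral.\<close>

definition branch :: "(nat \<Rightarrow> 'j) \<Rightarrow> 'a \<Rightarrow> 'k::{real_normed_field,banach}" where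
  "branch t x = of_real (enn2real (mass t x) powr (1 / p))"

lemma node_term_measurable:
  assumes t: "t \<in> seqs J"
  shows "(\<lambda>x. ennreal ((1 / 2) ^ n * u (node t n) x)) \<in> borel_measurable M"
proof -
  have [measurable]: "u (node t n) \<in> borel_measurable M"
    by (rule borel_measurable_integrable[OF u_int[OF node_in[OF t]]])
  show ?thesis by measurable
qed

lemma mass_measurable: "t \<in> seqs J \<Longrightarrow> mass t \<in> borel_measurable M"
proof -
  assume "t \<in> seqs J"
  note [measurable] = node_term_measurable[OF this]
  show ?thesis unfolding mass_def by measurable
qed

text \<open>Termwise integration leaves a geometric series times \<open>W\<close>.\<close>

lemma nn_integral_mass:
  assumes t: "t \<in> seqs J"
  shows "(\<integral>\<^sup>+x. mass t x \<partial>M) < \<infinity>"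
proof -
  \<comment> \<open>\<open>W\<close> is nonnegative because it dominates the integral of a
    nonnegative function.\<close>
  have "0 \<le> (\<integral>x. u (node t 0) x \<partial>M)"
    by (rule Bochner_Integration.integral_nonneg) (rule u_nonneg[OF node_in[OF t]])
  then have W: "W \<ge> 0" using u_bound[OF node_in[OF t, of 0]] by linarith
  have "(\<integral>\<^sup>+x. mass t x \<partial>M) = (\<Sum>n. \<integral>\<^sup>+x. ennreal ((1 / 2) ^ n * u (node t n) x) \<partial>M)"
    unfolding mass_def by (rule nn_integral_suminf[OF node_term_measurable[OF t]])
  also have "\<dots> \<le> (\<Sum>n. ennreal ((1 / 2) ^ n * W))"
  proof (intro suminf_le allI)
    fix n
    note j = node_in[OF t, of n]
    have "(\<integral>\<^sup>+x. ennreal ((1 / 2) ^ n * u (node t n) x) \<partial>M) = ennreal (\<integral>x. (1 / 2) ^ n * u (node t n) x \<partial>M)"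
      using u_int[OF j] u_nonneg[OF j] by (intro nn_integral_eq_integral) auto
    also have "\<dots> \<le> ennreal ((1 / 2) ^ n * W)"
      using u_bound[OF j] by (intro ennreal_leI) simp
    finally show "(\<integral>\<^sup>+x. ennreal ((1 / 2) ^ n * u (node t n) x) \<partial>M) \<le> ennreal ((1 / 2) ^ n * W)" .
  qed auto
  also have "\<dots> = ennreal (\<Sum>n. (1 / 2) ^ n * W)"
    using W by (intro suminf_ennreal2) (auto intro!: summable_mult2 summable_geometric)
  finally show ?thesis by (auto intro: order.strict_trans1)
qed

lemma branch_in_Ls:
  assumes t: "t \<in> seqs J"
  shows "(branch t :: 'a \<Rightarrow> 'k::{real_normed_field,banach}) \<in> Ls M p"
proof -
  have m: "(\<lambda>x. enn2real (mass t x)) \<in> borel_measurable M"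
    using mass_measurable[OF t] by measurable
  then have "(\<lambda>x. enn2real (mass t x) powr (1 / p)) \<in> borel_measurable M" by measurable
  then have bm: "(branch t :: 'a \<Rightarrow> 'k) \<in> borel_measurable M"
    unfolding branch_def
    by (rule measurable_compose[OF _ borel_measurable_continuous_onI]) (intro continuous_intros)
  have e: "norm (branch t x :: 'k) powr p = enn2real (mass t x)" for x
    using p by (simp add: branch_def powr_powr)
  have "(\<integral>\<^sup>+x. ennreal (enn2real (mass t x)) \<partial>M) \<le> (\<integral>\<^sup>+x. mass t x \<partial>M)"
    by (intro nn_integral_mono) (metis ennreal_enn2real_if ennreal_zero_neq_top le_zero_eq linorder_linear order_refl top.extremum zero_le)
  then have "integrable M (\<lambda>x. enn2real (mass t x))"
    using nn_integral_mass[OF t] m by (intro integrableI_nonneg) (auto intro: order.strict_trans1)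
  then show ?thesis using bm by (simp add: Ls_def e)
qed

text \<open>By almost disjointness only a term with node \<open>j\<close> survives on
  \<open>D j\<close>, and the nodes of one branch are distinct.\<close>

lemma mass_on_D:
  assumes t: "t \<in> seqs J" and j: "j \<in> J"
  shows "AE x in M. x \<in> D j \<longrightarrow> (\<forall>n. node t n = j \<longrightarrow> mass t x = ennreal ((1 / 2) ^ n * u j x))
    \<and> ((\<forall>n. node t n \<noteq> j) \<longrightarrow> mass t x = 0)"
proof -
  have "AE x in M. \<forall>n. node t n \<noteq> j \<longrightarrow> \<not> (x \<in> D (node t n) \<and> x \<in> D j)"
    unfolding AE_all_countable using D_disj[OF node_in[OF t] j] by auto
  then show ?thesis
  proof eventually_elim
    case (elim x)
    have z: "u (node t n) x = 0" if "x \<in> D j" "node t n \<noteq> j" for n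
      using elim that u_zero[OF node_in[OF t]] by blast
    show ?case
    proof (intro impI conjI allI)
      fix n assume x: "x \<in> D j" and n: "node t n = j"
      have "u (node t m) x = 0" if "m \<noteq> n" for m
        using z[OF x, of m] node_eqD(1)[OF t t, of m n] that n by metis
      then have "mass t x = (\<Sum>m\<in>{n}. ennreal ((1 / 2) ^ m * u (node t m) x))"
        unfolding mass_def by (intro suminf_finite) auto
      then show "mass t x = ennreal ((1 / 2) ^ n * u j x)" using n by simp
    next
      assume "x \<in> D j" "\<forall>n. node t n \<noteq> j"
      then show "mass t x = 0" unfolding mass_def using z by simp
    qed
  qed
qed

lemma branch_on_D:
  assumes t: "t \<in> seqs J" and j: "j \<in> J"
  shows "node t n = j \<Longrightarrow> AE x in M. x \<in> D j \<longrightarrow>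
      (branch t x :: 'k::{real_normed_field,banach}) = of_real (((1 / 2) ^ n) powr (1 / p)) * of_real (u j x powr (1 / p))"
    and "(\<And>n. node t n \<noteq> j) \<Longrightarrow> AE x in M. x \<in> D j \<longrightarrow> (branch t x :: 'k) = 0"
proof -
  assume n: "node t n = j"
  show "AE x in M. x \<in> D j \<longrightarrow>
      (branch t x :: 'k) = of_real (((1 / 2) ^ n) powr (1 / p)) * of_real (u j x powr (1 / p))"
    using mass_on_D[OF t j]
  proof eventually_elim
    case (elim x)
    show ?case
    proof
      assume "x \<in> D j"
      then have "mass t x = ennreal ((1 / 2) ^ n * u j x)" using elim n by blast
      then have "enn2real (mass t x) = (1 / 2) ^ n * u j x"
        using u_nonneg[OF j, of x] by simp
      then show "(branch t x :: 'k) = of_real (((1 / 2) ^ n) powr (1 / p)) * of_real (u j x powr (1 / p))"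
        by (simp add: branch_def powr_mult)
    qed
  qed
next
  assume "\<And>n. node t n \<noteq> j"
  with mass_on_D[OF t j] show "AE x in M. x \<in> D j \<longrightarrow> (branch t x :: 'k) = 0"
    by (auto elim!: eventually_mono simp: branch_def)
qed

lemma branch_in_spike_space:
  assumes t: "t \<in> seqs J"
  shows "(branch t :: 'a \<Rightarrow> 'k::{real_normed_field,banach}) \<in> spike_space"
proof (rule spike_spaceI[OF branch_in_Ls[OF t]])
  fix j assume j: "j \<in> J"
  show "\<exists>a. AE x in M. x \<in> D j \<longrightarrow> (branch t x :: 'k) = a * of_real (u j x powr (1 / p))"
  proof (cases "\<exists>n. node t n = j")
    case True
    then show ?thesis using branch_on_D(1)[OF t j] by blast
  next
    case False
    then have "AE x in M. x \<in> D j \<longrightarrow> (branch t x :: 'k) = 0 * of_real (u j x powr (1 / p))"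
      using branch_on_D(2)[OF t j] by auto
    then show ?thesis by blast
  qed
next
  fix E assume "E \<in> fin_sets M" and E: "\<And>j. j \<in> J \<Longrightarrow> AE x in M. \<not> (x \<in> E \<and> x \<in> D j)"
  have "AE x in M. \<forall>n. \<not> (x \<in> E \<and> x \<in> D (node t n))"
    unfolding AE_all_countable using E node_in[OF t] by blast
  then show "AE x in M. x \<in> E \<longrightarrow> (branch t x :: 'k) = 0"
    by (auto elim!: eventually_mono simp: branch_def mass_def u_zero[OF node_in[OF t]])
qed

text \<open>At sufficient depth \<open>t\<close> has a node on none of the other finitely many
  branches. On the support of that node the sum reduces to \<open>c t\<close> times a positive
  function.\<close>

lemma branch_independent:
  fixes c :: "(nat \<Rightarrow> 'j) \<Rightarrow> 'k::{real_normed_field,banach}"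
  assumes X: "finite X" "X \<subseteq> seqs J" and sum0: "AE x in M. (\<Sum>t\<in>X. c t * branch t x) = 0" and t: "t \<in> X"
  shows "c t = 0"
proof -
  have tJ: "t \<in> seqs J" using t X by blast
  have "\<exists>n. \<forall>t'\<in>X - {t}. \<exists>i<n. t i \<noteq> t' i"
  proof -
    have "\<forall>t'\<in>X - {t}. \<exists>i. t i \<noteq> t' i" by auto
    then obtain d where d: "\<And>t'. t' \<in> X - {t} \<Longrightarrow> t (d t') \<noteq> t' (d t')" by metis
    \<comment> \<open>The prefix of length \<open>n\<close> holds the indices below
      \<open>n\<close>, so the depth must exceed the largest index of difference.\<close>
    have "d t' < Suc (Max (d ` (X - {t})))" if "t' \<in> X - {t}" for t'
      using that X(1) by (intro le_imp_less_Suc Max_ge) auto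
    then show ?thesis using d by blast
  qed
  then obtain n where n: "\<And>t'. t' \<in> X \<Longrightarrow> t' \<noteq> t \<Longrightarrow> \<exists>i<n. t i \<noteq> t' i" by blast
  define j where "j = node t n"
  have j: "j \<in> J" using node_in[OF tJ] by (simp add: j_def)
  have other: "AE x in M. x \<in> D j \<longrightarrow> (branch t' x :: 'k) = 0" if t': "t' \<in> X - {t}" for t'
  proof (rule branch_on_D(2)[OF _ j])
    show t'J: "t' \<in> seqs J" using t' X by blast
    show "node t' m \<noteq> j" for m
    proof
      assume "node t' m = j"
      then have e: "node t n = node t' m" by (simp add: j_def)
      obtain i where "i < n" "t i \<noteq> t' i" using n t' by blast
      then show False using node_eqD(2)[OF tJ t'J e] by blast
    qed
  qed
  have "AE x in M. \<forall>t'\<in>X - {t}. x \<in> D j \<longrightarrow> (branch t' x :: 'k) = 0"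
    using X(1) other by (intro AE_finite_allI) auto
  moreover note sum0 branch_on_D(1)[OF tJ j j_def[symmetric], where 'k = 'k]
  ultimately have ae: "AE x in M. x \<in> D j \<longrightarrow>
      c t * (of_real (((1 / 2) ^ n) powr (1 / p)) * of_real (u j x powr (1 / p))) = 0"
  proof eventually_elim
    case (elim x)
    show ?case
    proof
      assume x: "x \<in> D j"
      have "(\<Sum>t\<in>X. c t * branch t x) = c t * branch t x"
        using elim x X(1) t by (simp add: sum.remove[of X t])
      then show "c t * (of_real (((1 / 2) ^ n) powr (1 / p)) * of_real (u j x powr (1 / p))) = 0"
        using elim x by simp
    qed
  qed
  obtain x where x: "x \<in> D j"
    "x \<in> D j \<longrightarrow> c t * (of_real (((1 / 2) ^ n) powr (1 / p)) * of_real (u j x powr (1 / p))) = 0"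
    using ex_point[OF j ae] by blast
  then show ?thesis using u_pos[OF j x(1)] by simp
qed

lemma inj_branch: "inj_on (branch :: _ \<Rightarrow> 'a \<Rightarrow> 'k::{real_normed_field,banach}) (seqs J)"
proof (rule inj_onI, rule ccontr)
  fix t t' assume t: "t \<in> seqs J" "t' \<in> seqs J" "t \<noteq> t'" and e: "(branch t :: 'a \<Rightarrow> 'k) = branch t'"
  have "(if t = t then 1 else - 1 :: 'k) = 0"
    by (rule branch_independent[of "{t, t'}" "\<lambda>s. if s = t then 1 else - 1" t]) (use t e in auto)
  then show False by simp
qed

lemma lin_indep_branch: "lin_indep_ae M (branch ` seqs J :: ('a \<Rightarrow> 'k::{real_normed_field,banach}) set)"
  unfolding lin_indep_ae_def
proof (intro allI impI ballI)
  fix F :: "('a \<Rightarrow> 'k) set" and c b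
  assume F: "finite F" "F \<subseteq> branch ` seqs J" and s: "AE x in M. (\<Sum>b\<in>F. c b * b x) = 0" and b: "b \<in> F"
  obtain X where X: "X \<subseteq> seqs J" "F = branch ` X" using F(2) by (auto simp: subset_image_iff)
  have inj: "inj_on (branch :: _ \<Rightarrow> 'a \<Rightarrow> 'k) X" using inj_branch X(1) inj_on_subset by blast
  have fin: "finite X" using F(1) X(2) inj finite_image_iff by blast
  obtain t where t: "t \<in> X" "b = branch t" using b X by blast
  have "c (branch t) = 0"
  proof (rule branch_independent[OF fin X(1) _ t(1), of "\<lambda>t. c (branch t)"])
    show "AE x in M. (\<Sum>t\<in>X. c (branch t) * branch t x) = 0"
      using s unfolding X(2) by (simp add: sum.reindex[OF inj])
  qed
  then show "c b = 0" using t by simp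
qed

text \<open>A basis \<open>B\<close> of the spike space containing the branches is extended to a
  basis \<open>C\<close> of L_p. The chain from \<open>C\<close> through
  \<open>seqs (ent_classes M)\<close>, \<open>seqs J\<close> and the branches returns to
  \<open>B\<close>, which closes the comparison.\<close>

lemma maximal_spaceable:
  assumes ent: "seqs (ent_classes M) \<lesssim> seqs J"
  shows "maximal_spaceable_Lp M p
    (Ls M p - (\<Union>q\<in>{q. 1 \<le> q \<and> q < p}. Ls M q) :: ('a \<Rightarrow> 'k::{real_normed_field,banach}) set)"
proof -
  let ?S = "spike_space :: ('a \<Rightarrow> 'k) set" and ?I = "branch ` seqs J :: ('a \<Rightarrow> 'k) set"
  have "?I \<subseteq> ?S" using branch_in_spike_space by blast
  then obtain B where B: "?I \<subseteq> B" "hamel_basis_ae M B ?S"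
    using hamel_basis_extend lin_indep_branch by metis
  then have "B \<subseteq> Ls M p" "lin_indep_ae M B"
    using spike_spaceD(1) unfolding hamel_basis_ae_def by blast+
  then obtain C where C: "B \<subseteq> C" "hamel_basis_ae M C (Ls M p)"
    using hamel_basis_extend by metis
  have "C \<lesssim> seqs (ent_classes M)"
    using C(2) p unfolding hamel_basis_ae_def by (intro lin_indep_lepoll_seqs_ent[of C M p]) auto
  also note ent
  also have "seqs J \<lesssim> ?I"
    using inj_branch unfolding lepoll_def by blast
  also have "?I \<lesssim> B" using B(1) by (rule subset_imp_lepoll)
  finally have "C \<lesssim> B" .
  moreover have "B \<lesssim> C" using C(1) by (rule subset_imp_lepoll)
  ultimately have "B \<approx> C" by (simp add: lepoll_antisym)
  moreover have "f \<in> Ls M p - (\<Union>q\<in>{q. 1 \<le> q \<and> q < p}. Ls M q) \<or> (AE x in M. f x = 0)" if "f \<in> ?S" for f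
    using spike_spaceD(1)[OF that] spike_space_not_Ls[OF that] by blast
  ultimately show ?thesis
    unfolding maximal_spaceable_Lp_def using closed_subspace_spike_space B(2) C(2) by blast
qed

end

subsection \<open>Building spikes from fat sets\<close>

text \<open>The differences of 1 / ln telescope and behave like 1 / (k (ln k)^2), so any power below
  1 eventually dominates the harmonic series.\<close>

lemma borderline_weights:
  obtains w :: "nat \<Rightarrow> real" where "\<And>k. w k > 0" "summable w"
    "\<And>s. 0 < s \<Longrightarrow> s < 1 \<Longrightarrow> \<not> summable (\<lambda>k. w k powr s)"
proof -
  define w where "w = (\<lambda>k::nat. 1 / ln (real k + 2) - 1 / ln (real k + 3))"
  have pos: "w k > 0" for k
    by (auto simp: w_def intro!: divide_strict_left_mono)
  have "(\<lambda>k. 1 / ln (real k + 2)) \<longlonglongrightarrow> 0" by real_asymp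
  then have "(\<lambda>k. 1 / ln (real k + 2) - 1 / ln (real (Suc k) + 2)) sums (1 / ln (real 0 + 2) - 0)"
    by (rule telescope_sums')
  then have "summable w"
    by (auto simp: w_def add.commute sums_iff)
  moreover have "\<not> summable (\<lambda>k. w k powr s)" if s: "0 < s" "s < 1" for s
  proof
    assume "summable (\<lambda>k. w k powr s)"
    moreover have "eventually (\<lambda>k. norm (1 / real k) \<le> w k powr s) sequentially"
    proof -
      \<comment> \<open>Growth of w_k k^(1/s) beyond 1 gives w_k^s \<ge> 1/k after raising to the
        power \<open>s\<close>.\<close>
      have "filterlim (\<lambda>k. (1 / ln (real k + 2) - 1 / ln (real k + 3)) * real k powr (1 / s)) at_top sequentially"
        using s by real_asymp
      then have "eventually (\<lambda>k. w k * real k powr (1 / s) \<ge> 1) sequentially"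
        unfolding w_def filterlim_at_top by blast
      then show ?thesis
        using eventually_gt_at_top[of 0]
      proof eventually_elim
        case (elim k)
        have "1 powr s \<le> (w k * real k powr (1 / s)) powr s"
          using elim s by (intro powr_mono2) auto
        also have "\<dots> = w k powr s * real k"
          using elim s pos[of k] by (simp add: powr_mult powr_powr)
        finally show ?case using elim by (simp add: field_simps)
      qed
    qed
    ultimately have "summable (\<lambda>k. 1 / real k)"
      by (rule summable_comparison_test_ev[rotated])
    then show False using not_summable_harmonic[where 'a = real] by (simp add: inverse_eq_divide)
  qed
  ultimately show ?thesis using pos that by blast
qed

lemma AE_disjoint_disjointed:
  fixes A :: "nat \<Rightarrow> 'a set"
  assumes "\<And>k l. k \<noteq> l \<Longrightarrow> AE x in M. \<not> (x \<in> A k \<and> x \<in> A l)"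
  shows "AE x in M. \<forall>k. x \<in> disjointed A k \<longleftrightarrow> x \<in> A k"
proof -
  have "AE x in M. \<forall>k l. k \<noteq> l \<longrightarrow> \<not> (x \<in> A k \<and> x \<in> A l)"
    unfolding AE_all_countable using assms by auto
  then show ?thesis
    by eventually_elim (auto simp: disjointed_def, metis less_irrefl)
qed

text \<open>On the k-th set, made disjoint from its predecessors, \<open>u\<close> has the value w_k
  / m_k with m_k the measure. The integral is then the sum of the w_k, while the integral of the
  power \<open>s\<close> is the sum of w_k^s m_k^(1-s), which diverges because m_k \<ge>
  \<open>\<delta>\<close>.\<close>

lemma ex_spike:
  fixes A :: "nat \<Rightarrow> 'a set" and \<delta> :: real
  assumes w: "\<And>k. w k > 0" "summable w" "\<And>s. 0 < s \<Longrightarrow> s < 1 \<Longrightarrow> \<not> summable (\<lambda>k. w k powr s)"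
    and A: "\<And>k. A k \<in> fin_sets M" and \<delta>: "\<delta> > 0" "\<And>k. \<delta> \<le> measure M (A k)"
    and disj: "\<And>k l. k \<noteq> l \<Longrightarrow> AE x in M. \<not> (x \<in> A k \<and> x \<in> A l)"
  obtains u :: "'a \<Rightarrow> real" where "integrable M u" "\<And>x. 0 \<le> u x"
    "\<And>x. x \<in> (\<Union>k. A k) \<Longrightarrow> 0 < u x" "\<And>x. x \<notin> (\<Union>k. A k) \<Longrightarrow> u x = 0"
    "(\<integral>x. u x \<partial>M) \<le> suminf w"
    "\<And>s. 0 < s \<Longrightarrow> s < 1 \<Longrightarrow> \<not> integrable M (\<lambda>x. u x powr s)"
proof -
  define m where "m = (\<lambda>k. measure M (A k))"
  have m0: "m k > 0" for k using \<delta> by (auto simp: m_def intro: less_le_trans)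
  have dsets: "disjointed A k \<in> sets M" for k
    using sets.range_disjointed_sets[of A M] fin_setsD(1)[OF A] by blast
  have em: "emeasure M (disjointed A k) = ennreal (m k)" for k
  proof -
    have "emeasure M (disjointed A k) = emeasure M (A k)"
    proof (rule emeasure_eq_AE)
      have "AE x in M. \<forall>k. x \<in> disjointed A k \<longleftrightarrow> x \<in> A k"
        by (rule AE_disjoint_disjointed) (rule disj)
      then show "AE x in M. x \<in> disjointed A k \<longleftrightarrow> x \<in> A k" by eventually_elim blast
    qed (use dsets fin_setsD(1)[OF A] in auto)
    also have "\<dots> = ennreal (m k)"
      using fin_setsD(2)[OF A, of k] by (simp add: m_def emeasure_eq_ennreal_measure less_top)
    finally show ?thesis .
  qed
  define G where "G = (\<lambda>c x. \<Sum>k. ennreal (c k) * indicator (disjointed A k) x)"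
  have G_in: "G c x = ennreal (c k)" if "x \<in> disjointed A k" for c x k
  proof -
    have "x \<notin> disjointed A l" if "l \<noteq> k" for l
      using disjoint_family_onD[OF disjoint_family_disjointed[of A], of l k] \<open>x \<in> disjointed A k\<close> that
      by auto
    then have "G c x = (\<Sum>l\<in>{k}. ennreal (c l) * indicator (disjointed A l) x)"
      unfolding G_def by (intro suminf_finite) auto
    then show ?thesis using that by simp
  qed
  have G_out: "G c x = 0" if "x \<notin> (\<Union>k. A k)" for c x
  proof -
    have "x \<notin> disjointed A k" for k using that disjointed_subset[of A k] by blast
    then show ?thesis by (simp add: G_def)
  qed
  have G_meas: "G c \<in> borel_measurable M" for c
    unfolding G_def using dsets by measurable
  have G_int: "(\<integral>\<^sup>+x. G c x \<partial>M) = (\<Sum>k. ennreal (c k) * ennreal (m k))" for c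
    unfolding G_def using dsets by (subst nn_integral_suminf) (auto simp: nn_integral_cmult em)
  define c where "c = (\<lambda>k. w k / m k)"
  have c0: "c k > 0" for k using w m0 by (simp add: c_def)
  define u where "u = (\<lambda>x. enn2real (G c x))"
  have cases_x: "(\<exists>k. x \<in> disjointed A k) \<or> x \<notin> (\<Union>k. A k)" for x
    using UN_disjointed_eq[of A] by blast
  have u_G: "ennreal (u x powr s) = G (\<lambda>k. c k powr s) x" for x s
    using cases_x[of x] c0 by (auto simp: u_def G_in G_out less_imp_le)
  have u_G1: "ennreal (u x) = G c x" for x
    using cases_x[of x] c0 by (auto simp: u_def G_in G_out less_imp_le)
  have um: "u \<in> borel_measurable M" unfolding u_def using G_meas by measurable
  have "(\<integral>\<^sup>+x. ennreal (u x) \<partial>M) = (\<Sum>k. ennreal (w k))"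
    proof -
    have "ennreal (c k) * ennreal (m k) = ennreal (w k)" for k
      using c0[of k] m0[of k] by (simp add: c_def flip: ennreal_mult)
    then show ?thesis unfolding u_G1 G_int by simp
  qed
  also have "\<dots> = ennreal (suminf w)"
    by (rule suminf_ennreal2[OF less_imp_le[OF w(1)] w(2)])
  finally have ui: "(\<integral>\<^sup>+x. ennreal (u x) \<partial>M) = ennreal (suminf w)" .
  have u0: "u x \<ge> 0" for x by (simp add: u_def)
  have int: "integrable M u"
    using um u0 ui by (intro integrableI_nonneg) auto
  show ?thesis
  proof
    show "0 < u x" if "x \<in> (\<Union>k. A k)" for x
      using cases_x[of x] that c0 by (auto simp: u_def G_in less_imp_le)
    show "u x = 0" if "x \<notin> (\<Union>k. A k)" for x using that by (simp add: u_def G_out)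
    have "suminf w \<ge> 0" by (rule suminf_nonneg[OF w(2) less_imp_le[OF w(1)]])
    then show "(\<integral>x. u x \<partial>M) \<le> suminf w"
      using ui u0 um by (subst integral_eq_nn_integral) auto
    fix s :: real assume s: "0 < s" "s < 1"
    show "\<not> integrable M (\<lambda>x. u x powr s)"
    proof
      assume i: "integrable M (\<lambda>x. u x powr s)"
      have eq: "c k powr s * m k = w k powr s * m k powr (1 - s)" for k
        using w(1)[of k] m0[of k] by (simp add: c_def powr_divide powr_diff)
      have "(\<Sum>k. ennreal (\<delta> powr (1 - s) * w k powr s)) \<le> (\<Sum>k. ennreal (c k powr s) * ennreal (m k))"
      proof (intro suminf_le allI)
        fix k
        have "\<delta> powr (1 - s) * w k powr s \<le> c k powr s * m k"
          unfolding eq using \<delta> s by (simp add: m_def mult.commute powr_mono2 mult_left_mono)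
        then show "ennreal (\<delta> powr (1 - s) * w k powr s) \<le> ennreal (c k powr s) * ennreal (m k)"
          using m0[of k] by (simp add: ennreal_leI flip: ennreal_mult)
      qed auto
      also have "\<dots> = (\<integral>\<^sup>+x. ennreal (u x powr s) \<partial>M)" unfolding u_G G_int ..
      also have "\<dots> < \<infinity>" using i by (simp add: integrable_iff_bounded)
      finally have "summable (\<lambda>k. \<delta> powr (1 - s) * w k powr s)"
        by (intro summable_suminf_not_top) auto
      then have "summable (\<lambda>k. w k powr s)" using \<delta>(1) by simp
      then show False using w(3)[OF s] by blast
    qed
  qed (use int u0 in auto)
qed

text \<open>Each row \<open>A j\<close> carries one spike. The bound \<open>\<delta> j\<close> may
  vary with the row, but all rows use the same weights, whose sum is the common bound on the
  integrals.\<close>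

lemma maximal_spaceable_from_sets:
  fixes M :: "'a measure" and A :: "'j \<Rightarrow> nat \<Rightarrow> 'a set"
  assumes p: "p > 1" and J: "infinite J"
    and A: "\<And>j k. j \<in> J \<Longrightarrow> A j k \<in> fin_sets M"
    and \<delta>: "\<And>j. j \<in> J \<Longrightarrow> \<delta> j > 0" "\<And>j k. j \<in> J \<Longrightarrow> \<delta> j \<le> measure M (A j k)"
    and disj: "\<And>i j k l. i \<in> J \<Longrightarrow> j \<in> J \<Longrightarrow> (i, k) \<noteq> (j, l) \<Longrightarrow> AE x in M. \<not> (x \<in> A i k \<and> x \<in> A j l)"
    and ent: "seqs (ent_classes M) \<lesssim> seqs J"
  shows "maximal_spaceable_Lp M p
    (Ls M p - (\<Union>q\<in>{q. 1 \<le> q \<and> q < p}. Ls M q) :: ('a \<Rightarrow> 'k::{real_normed_field,banach}) set)"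
proof -
  obtain w :: "nat \<Rightarrow> real" where w: "\<And>k. w k > 0" "summable w"
    "\<And>s. 0 < s \<Longrightarrow> s < 1 \<Longrightarrow> \<not> summable (\<lambda>k. w k powr s)"
    using borderline_weights by blast
  define good where "good = (\<lambda>j u. integrable M u \<and> (\<forall>x. 0 \<le> u x) \<and>
      (\<forall>x\<in>(\<Union>k. A j k). 0 < u x) \<and> (\<forall>x. x \<notin> (\<Union>k. A j k) \<longrightarrow> u x = 0) \<and>
      (\<integral>x. u x \<partial>M) \<le> suminf w \<and> (\<forall>s. 0 < s \<longrightarrow> s < 1 \<longrightarrow> \<not> integrable M (\<lambda>x. u x powr s)))"
  have "\<exists>u. good j u" if j: "j \<in> J" for j
    by (rule ex_spike[OF w A[OF j] \<delta>(1)[OF j] \<delta>(2)[OF j], of "\<lambda>k. k"])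
      (use disj[OF j j] in \<open>auto simp: good_def\<close>)
  then obtain u where "\<And>j. j \<in> J \<Longrightarrow> good j (u j)" by metis
  then have u: "integrable M (u j)" "0 \<le> u j x" "x \<in> (\<Union>k. A j k) \<Longrightarrow> 0 < u j x"
    "x \<notin> (\<Union>k. A j k) \<Longrightarrow> u j x = 0" "(\<integral>x. u j x \<partial>M) \<le> suminf w"
    "0 < s \<Longrightarrow> s < 1 \<Longrightarrow> \<not> integrable M (\<lambda>x. u j x powr s)" if "j \<in> J" for j x s
    using that unfolding good_def by blast+
  interpret spike_family M p J "\<lambda>j. \<Union>k. A j k" u "suminf w"
  proof
    fix i j assume ij: "i \<in> J" "j \<in> J" "i \<noteq> j"
    have "AE x in M. \<forall>k l. \<not> (x \<in> A i k \<and> x \<in> A j l)"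
      unfolding AE_all_countable using disj[OF ij(1,2)] ij(3) by auto
    then show "AE x in M. \<not> (x \<in> (\<Union>k. A i k) \<and> x \<in> (\<Union>k. A j k))"
      by eventually_elim auto
  next
    fix j assume "j \<in> J"
    then show "(\<Union>k. A j k) \<in> sets M" using fin_setsD(1)[OF A] by auto
  qed (use p J u in auto)
  show ?thesis by (rule maximal_spaceable[OF ent])
qed

section \<open>Dyadic level sets and case (a)\<close>

lemma ex_dyadic:
  fixes t :: real
  assumes "0 < t" "t \<le> (1 / 2) ^ K"
  obtains k where "K \<le> k" "(1 / 2) ^ Suc k < t" "t \<le> (1 / 2) ^ k"
proof -
  define P where "P = (\<lambda>k. (1 / 2) ^ Suc k < t)"
  obtain n where "(1 / 2) ^ n < t" using real_arch_pow_inv[of t "1 / 2"] assms(1) by auto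
  moreover have "((1::real) / 2) ^ Suc n \<le> (1 / 2) ^ n" by simp
  ultimately have "P n" unfolding P_def by linarith
  then have P: "P (Least P)" by (rule LeastI)
  show ?thesis
  proof (rule that[of "Least P"])
    show "(1 / 2) ^ Suc (Least P) < t" using P by (simp add: P_def)
    then have "((1::real) / 2) ^ Suc (Least P) < (1 / 2) ^ K" using assms(2) by linarith
    then have "\<not> Suc (Least P) \<le> K" using power_decreasing[of "Suc (Least P)" K "1 / 2 :: real"] by auto
    then show "K \<le> Least P" by simp
    show "t \<le> (1 / 2) ^ Least P"
    proof (cases "Least P")
      case 0
      have "((1::real) / 2) ^ K \<le> 1" by (intro power_le_one) auto
      then show ?thesis using assms(2) 0 by simp
    next
      case (Suc n)
      then have "\<not> P n" using not_less_Least[of n P] by simp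
      then show ?thesis using Suc by (simp add: P_def)
    qed
  qed
qed

text \<open>Suppose all levels from \<open>K\<close> on have measure below 1. Then the small values
  contribute at most a geometric series to the integral of |f|^r, and the large values are
  controlled by |f|^p, which puts \<open>f\<close> into L_r.\<close>

lemma infinitely_many_fat_levels:
  fixes f :: "'a \<Rightarrow> 'k::{real_normed_field,banach}"
  assumes f: "f \<in> Ls M p" "f \<notin> Ls M r" and r: "1 \<le> r" "r < p"
  defines "E \<equiv> (\<lambda>k::nat. f -` {y. (1 / 2) ^ Suc k < norm y \<and> norm y \<le> (1 / 2) ^ k} \<inter> space M)"
  shows "E k \<in> fin_sets M" "infinite {k. 1 \<le> measure M (E k)}"
proof -
  have fm: "f \<in> borel_measurable M" and int: "integrable M (\<lambda>x. norm (f x) powr p)"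
    using f by (auto simp: Ls_def)
  have fin: "E k \<in> fin_sets M" for k
    unfolding E_def
  proof (rule Ls_superlevel_fin[OF f(1), where \<delta> = "(1 / 2) ^ Suc k"])
    have "{y::'k. (1 / 2) ^ Suc k < norm y} \<in> sets borel"
      by (intro borel_open open_Collect_less continuous_intros)
    moreover have "{y::'k. norm y \<le> (1 / 2) ^ k} \<in> sets borel"
      by (intro borel_closed closed_Collect_le continuous_intros)
    ultimately have "{y::'k. (1 / 2) ^ Suc k < norm y} \<inter> {y. norm y \<le> (1 / 2) ^ k} \<in> sets borel"
      by (rule sets.Int)
    then show "{y::'k. (1 / 2) ^ Suc k < norm y \<and> norm y \<le> (1 / 2) ^ k} \<in> sets borel"
      by (simp add: Collect_conj_eq)
  qed (use r in auto)
  then show "E k \<in> fin_sets M" .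
  show "infinite {k. 1 \<le> measure M (E k)}"
  proof
    assume "finite {k. 1 \<le> measure M (E k)}"
    then obtain K where K: "\<And>k. 1 \<le> measure M (E k) \<Longrightarrow> k < K"
      using finite_nat_set_iff_bounded by auto
    \<comment> \<open>Since r - p < 0, this bounds t^(r-p) for all t above (1/2)^K.\<close>
    define C where "C = ((1 / 2) ^ K :: real) powr (r - p)"
    define c where "c = (\<lambda>k. if K \<le> k then (1 / 2 :: real) ^ k else 0)"
    define S where "S = (\<lambda>x. \<Sum>k. ennreal (c k) * indicator (E k) x)"
    have Ssets [measurable]: "E k \<in> sets M" for k using fin_setsD(1)[OF fin] .
    have S_meas: "S \<in> borel_measurable M"
      unfolding S_def by measurable
    have S_int: "(\<integral>\<^sup>+x. S x \<partial>M) < \<infinity>"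
    proof -
      have "(\<integral>\<^sup>+x. S x \<partial>M) = (\<Sum>k. \<integral>\<^sup>+x. ennreal (c k) * indicator (E k) x \<partial>M)"
        unfolding S_def by (rule nn_integral_suminf) measurable
      also have "\<dots> \<le> (\<Sum>k. ennreal ((1 / 2) ^ k))"
      proof (intro suminf_le allI)
        fix k
        show "(\<integral>\<^sup>+x. ennreal (c k) * indicator (E k) x \<partial>M) \<le> ennreal ((1 / 2) ^ k)"
        proof (cases "K \<le> k")
          case True
          then have "measure M (E k) \<le> 1" using K[of k] by linarith
          then have "emeasure M (E k) \<le> 1"
            using fin_setsD(2)[OF fin, of k] by (simp add: emeasure_eq_ennreal_measure less_top ennreal_le_1)
          then have "ennreal (c k) * emeasure M (E k) \<le> ennreal (c k)" by (rule mult_left_le) simp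
          then show ?thesis using True Ssets[of k] by (simp add: nn_integral_cmult c_def)
        qed (simp add: c_def)
      qed auto
      also have "\<dots> = ennreal (\<Sum>k. (1 / 2) ^ k)"
        by (intro suminf_ennreal2 summable_geometric) auto
      finally show ?thesis by (auto intro: order.strict_trans1)
    qed
    have bound: "ennreal (norm (f x) powr r) \<le> ennreal C * ennreal (norm (f x) powr p) + S x"
      if x: "x \<in> space M" for x
    proof (cases "(1 / 2) ^ K < norm (f x)")
      case True
      have "norm (f x) powr r = norm (f x) powr (r - p) * norm (f x) powr p"
        by (simp flip: powr_add)
      also have "\<dots> \<le> C * norm (f x) powr p"
        unfolding C_def using True r by (intro mult_right_mono powr_mono2') auto
      finally have "ennreal (norm (f x) powr r) \<le> ennreal C * ennreal (norm (f x) powr p)"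
        by (simp add: ennreal_leI C_def flip: ennreal_mult)
      then show ?thesis by (simp add: add_increasing2)
    next
      case False
      show ?thesis
      proof (cases "f x = 0")
        case False
        then obtain k where k: "K \<le> k" "(1 / 2) ^ Suc k < norm (f x)" "norm (f x) \<le> (1 / 2) ^ k"
          using ex_dyadic[of "norm (f x)" K] \<open>\<not> (1 / 2) ^ K < norm (f x)\<close> by auto
        then have xE: "x \<in> E k" using x by (simp add: E_def)
        have "norm (f x) powr r \<le> ((1 / 2) ^ k) powr r" using k r by (intro powr_mono2) auto
        \<comment> \<open>Here r \<ge> 1 enters: for a base at most 1 the larger exponent gives the
          smaller power.\<close>
        also have "\<dots> \<le> ((1 / 2) ^ k) powr 1"
          using r by (intro powr_mono') (auto simp: power_le_one)
        finally have "ennreal (norm (f x) powr r) \<le> ennreal ((1 / 2) ^ k)" by (simp add: ennreal_leI)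
        also have "\<dots> = (\<Sum>k\<in>{k}. ennreal (c k) * indicator (E k) x)"
          using k xE by (simp add: c_def)
        also have "\<dots> \<le> S x" unfolding S_def by (intro sum_le_suminf) auto
        finally show ?thesis by (simp add: add_increasing)
      qed simp
    qed
    have "(\<integral>\<^sup>+x. ennreal (norm (f x) powr r) \<partial>M)
        \<le> (\<integral>\<^sup>+x. ennreal C * ennreal (norm (f x) powr p) + S x \<partial>M)"
      by (intro nn_integral_mono bound)
    also have "\<dots> = ennreal C * (\<integral>\<^sup>+x. ennreal (norm (f x) powr p) \<partial>M) + (\<integral>\<^sup>+x. S x \<partial>M)"
      using borel_measurable_norm_powr[OF fm, of p] S_meas
      by (simp add: nn_integral_add nn_integral_cmult)
    also have "\<dots> < \<infinity>"
      using int S_int by (auto simp: integrable_iff_bounded ennreal_mult_less_top)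
    finally have "integrable M (\<lambda>x. norm (f x) powr r)"
      using borel_measurable_norm_powr[OF fm, of r] by (intro integrableI_nonneg) auto
    then show False using f(2) fm by (simp add: Ls_def)
  qed
qed

text \<open>Pairing arranges the fat levels in countably many rows. With at most continuum many
  classes there are at most continuum many sequences of classes, no more than sequences of
  naturals.\<close>

lemma maximal_spaceable_case_a:
  fixes M :: "'a measure" and f :: "'a \<Rightarrow> 'k::{real_normed_field,banach}"
  assumes p: "p > 1" and f: "f \<in> Ls M p" "f \<notin> Ls M r" and r: "1 \<le> r" "r < p"
    and ent: "ent_classes M \<lesssim> (UNIV :: real set)"
  shows "maximal_spaceable_Lp M p
    (Ls M p - (\<Union>q\<in>{q. 1 \<le> q \<and> q < p}. Ls M q) :: ('a \<Rightarrow> 'k) set)"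
proof -
  define E where "E = (\<lambda>k::nat. f -` {y. (1 / 2) ^ Suc k < norm y \<and> norm y \<le> (1 / 2) ^ k} \<inter> space M)"
  have E: "E k \<in> fin_sets M" "infinite {k. 1 \<le> measure M (E k)}" for k
    using infinitely_many_fat_levels[OF f r] unfolding E_def by auto
  have E_disj: "x \<notin> E l" if "x \<in> E k" "k < l" for x k l
  proof
    assume "x \<in> E l"
    then have "(1 / 2) ^ Suc k < norm (f x)" "norm (f x) \<le> (1 / 2) ^ l"
      using that by (auto simp: E_def)
    moreover have "((1::real) / 2) ^ l \<le> (1 / 2) ^ Suc k" using that by (intro power_decreasing) auto
    ultimately show False by linarith
  qed
  define e where "e = enumerate {k. 1 \<le> measure M (E k)}"
  have e: "inj e" "1 \<le> measure M (E (e k))" for k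
    using strict_mono_enumerate[OF E(2)] strict_mono_imp_inj_on enumerate_in_set[OF E(2)]
    unfolding e_def by blast+
  show ?thesis
  proof (rule maximal_spaceable_from_sets[OF p, of "UNIV :: nat set" "\<lambda>j k. E (e (prod_encode (j, k)))" M "\<lambda>_. 1"])
    fix i j k l :: nat
    assume "(i, k) \<noteq> (j, l)"
    then have "prod_encode (i, k) \<noteq> prod_encode (j, l)" by (simp add: prod_encode_eq)
    then have "e (prod_encode (i, k)) \<noteq> e (prod_encode (j, l))" using e(1) by (simp add: inj_eq)
    then have "e (prod_encode (i, k)) < e (prod_encode (j, l)) \<or> e (prod_encode (j, l)) < e (prod_encode (i, k))"
      by (rule nat_neq_iff[THEN iffD1])
    then have "\<not> (x \<in> E (e (prod_encode (i, k))) \<and> x \<in> E (e (prod_encode (j, l))))" for x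
      by (auto dest: E_disj)
    then show "AE x in M. \<not> (x \<in> E (e (prod_encode (i, k))) \<and> x \<in> E (e (prod_encode (j, l))))"
      by simp
  next
    show "seqs (ent_classes M) \<lesssim> seqs (UNIV :: nat set)"
      by (rule lepoll_trans[OF lepoll_trans[OF seqs_mono[OF ent] seqs_reals] reals_lepoll_seqs_nat])
  qed (use E e in auto)
qed

subsection \<open>Homogeneous sets\<close>

lemma Un_lepoll:
  assumes Z: "infinite Z" and "X \<lesssim> Z" "Y \<lesssim> Z"
  shows "X \<union> Y \<lesssim> Z"
proof -
  have "X \<union> Y = (\<Union>i\<in>{0, 1::nat}. if i = 0 then X else Y)" by auto
  also have "\<dots> \<lesssim> {0, 1::nat} \<times> Z" using assms by (intro UN_lepoll_times) auto
  also have "\<dots> \<lesssim> Z \<times> Z"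
    by (rule times_lepoll_mono[OF finite_lepoll_infinite[OF Z] lepoll_refl]) simp
  also have "\<dots> \<lesssim> Z" by (rule lepoll_times_self[OF Z])
  finally show ?thesis .
qed

text \<open>The hypothesis says that \<open>c\<close> factors through \<open>h\<close>.\<close>

lemma image_lepoll_image:
  assumes "\<And>x y. x \<in> X \<Longrightarrow> y \<in> X \<Longrightarrow> h x = h y \<Longrightarrow> c x = c y"
  shows "c ` X \<lesssim> h ` X"
proof -
  have "c ` X \<subseteq> (\<lambda>z. c (SOME x. x \<in> X \<and> h x = z)) ` (h ` X)"
  proof
    fix y assume "y \<in> c ` X"
    then obtain x where x: "x \<in> X" "y = c x" by blast
    have "(SOME x'. x' \<in> X \<and> h x' = h x) \<in> X \<and> h (SOME x'. x' \<in> X \<and> h x' = h x) = h x"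
      by (rule someI[of "\<lambda>x'. x' \<in> X \<and> h x' = h x" x]) (use x in auto)
    then have "y = c (SOME x'. x' \<in> X \<and> h x' = h x)" using assms x by metis
    then show "y \<in> (\<lambda>z. c (SOME x. x \<in> X \<and> h x = z)) ` (h ` X)" using x(1) by blast
  qed
  then show ?thesis by (rule subset_image_lepoll)
qed

definition null_on :: "'a measure \<Rightarrow> 'a set \<Rightarrow> bool" where
  "null_on M A \<longleftrightarrow> (AE x in M. x \<notin> A)"

definition ae_disj :: "'a measure \<Rightarrow> 'a set \<Rightarrow> 'a set \<Rightarrow> bool" where
  "ae_disj M A B \<longleftrightarrow> (AE x in M. \<not> (x \<in> A \<and> x \<in> B))"

definition sub_classes :: "'a measure \<Rightarrow> 'a set \<Rightarrow> 'a set set set" where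
  "sub_classes M A = (\<lambda>B. ae_sim M `` {B}) ` {B \<in> sets M. B \<subseteq> A}"

lemma empty_fin_sets: "{} \<in> fin_sets M"
  by (simp add: fin_sets_def)

lemma null_class:
  assumes "B \<in> fin_sets M" "null_on M B"
  shows "ae_sim M `` {B} = ae_sim M `` {{}}"
  using assms by (simp add: ae_class_eq_iff empty_fin_sets null_on_def)

lemma null_on_iff: "A \<in> sets M \<Longrightarrow> null_on M A \<longleftrightarrow> emeasure M A = 0"
  by (simp add: null_on_def null_iff_AE_not_mem)

definition homogeneous :: "'a measure \<Rightarrow> 'a set \<Rightarrow> bool" where
  "homogeneous M X \<longleftrightarrow> X \<in> fin_sets M \<and> \<not> null_on M X \<and>
     (\<forall>Y\<in>sets M. Y \<subseteq> X \<longrightarrow> \<not> null_on M Y \<longrightarrow> sub_classes M X \<lesssim> sub_classes M Y)"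

text \<open>Cardinals are well-ordered, so some nonnull subset of \<open>E\<close> has the least
  possible number of classes.\<close>

lemma ex_homogeneous:
  assumes E: "E \<in> fin_sets M" "\<not> null_on M E"
  obtains X where "X \<subseteq> E" "homogeneous M X"
proof -
  define \<X> where "\<X> = {X \<in> sets M. X \<subseteq> E \<and> \<not> null_on M X}"
  have "(card_of \<circ> sub_classes M) ` \<X> \<noteq> {}" using E fin_setsD(1) by (auto simp: \<X>_def)
  moreover have "\<forall>r\<in>(card_of \<circ> sub_classes M) ` \<X>. Card_order r" by (auto intro: card_of_Card_order)
  ultimately have "\<exists>r\<in>(card_of \<circ> sub_classes M) ` \<X>. \<forall>r'\<in>(card_of \<circ> sub_classes M) ` \<X>. (r, r') \<in> ordLeq"
    by (rule exists_minim_Card_order)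
  then obtain X where X: "X \<in> \<X>"
    "\<And>Y. Y \<in> \<X> \<Longrightarrow> (card_of (sub_classes M X), card_of (sub_classes M Y)) \<in> ordLeq"
    by auto
  have "sub_classes M X \<lesssim> sub_classes M Y" if "Y \<in> sets M" "Y \<subseteq> X" "\<not> null_on M Y" for Y
    unfolding lepoll_def card_of_ordLeq using that X(1) by (intro X(2)) (auto simp: \<X>_def)
  then have "homogeneous M X"
    using X(1) fin_sets_subset[OF E(1)] by (auto simp: homogeneous_def \<X>_def)
  then show ?thesis using X(1) by (intro that) (auto simp: \<X>_def)
qed

text \<open>Without atoms every nonnull subset splits into two nonnull parts, one of at most half
  the measure; iterating gives a small nonnull \<open>Y\<close>, which by homogeneity has as many
  classes as \<open>X\<close>. With an atom, homogeneity leaves \<open>X\<close> at most two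
  classes.\<close>

lemma homogeneous_small:
  assumes X: "homogeneous M X" and \<epsilon>: "\<epsilon> > 0"
  obtains Y where "Y \<in> sets M" "Y \<subseteq> X" "emeasure M Y \<le> ennreal \<epsilon>"
    "sub_classes M X \<lesssim> sub_classes M Y \<times> (UNIV :: bool set)"
proof -
  have Xfin: "X \<in> fin_sets M" and Xn: "\<not> null_on M X" using X by (auto simp: homogeneous_def)
  have Xle: "sub_classes M X \<lesssim> sub_classes M Y" if "Y \<in> sets M" "Y \<subseteq> X" "\<not> null_on M Y" for Y
    using X that unfolding homogeneous_def by blast
  define atom where "atom = (\<lambda>T. T \<in> sets M \<and> T \<subseteq> X \<and> \<not> null_on M T \<and>
    (\<forall>B\<in>sets M. B \<subseteq> T \<longrightarrow> null_on M B \<or> null_on M (T - B)))"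
  show ?thesis
  proof (cases "\<exists>T. atom T")
    case True
    then obtain T where T: "T \<in> sets M" "T \<subseteq> X" "\<not> null_on M T"
      "\<And>B. B \<in> sets M \<Longrightarrow> B \<subseteq> T \<Longrightarrow> null_on M B \<or> null_on M (T - B)"
      unfolding atom_def by blast
    have Tf: "T \<in> fin_sets M" using fin_sets_subset[OF Xfin] T by blast
    have "sub_classes M T \<subseteq> {ae_sim M `` {{}}, ae_sim M `` {T}}"
    proof
      fix c assume "c \<in> sub_classes M T"
      then obtain B where B: "B \<in> sets M" "B \<subseteq> T" "c = ae_sim M `` {B}" by (auto simp: sub_classes_def)
      have Bf: "B \<in> fin_sets M" using fin_sets_subset[OF Tf] B by blast
      show "c \<in> {ae_sim M `` {{}}, ae_sim M `` {T}}"
      proof (cases "null_on M B")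
        case True
        then show ?thesis using null_class[OF Bf] B by simp
      next
        case False
        then have "null_on M (T - B)" using T(4) B by blast
        then have "AE x in M. x \<in> B \<longleftrightarrow> x \<in> T"
          unfolding null_on_def using B(2) by (auto elim!: eventually_mono)
        then show ?thesis using ae_class_eq_iff[OF Bf Tf] B by simp
      qed
    qed
    then have "sub_classes M T \<lesssim> {ae_sim M `` {{}}, ae_sim M `` {T}}" by (rule subset_imp_lepoll)
    \<comment> \<open>The small piece is empty and has one class; the bit accounts for the two
      classes below the atom.\<close>
    also have "\<dots> \<lesssim> {ae_sim M `` {{}}} \<times> (UNIV :: bool set)"
      by (rule lepoll_iff_card_le[THEN iffD2]) (auto simp: card_insert_if)
    also have "{ae_sim M `` {{}}} = sub_classes M {}"
      by (auto simp: sub_classes_def)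
    finally have "sub_classes M X \<lesssim> sub_classes M {} \<times> (UNIV :: bool set)"
      using Xle[OF T(1,2,3)] lepoll_trans by blast
    then show ?thesis by (intro that[of "{}"]) auto
  next
    case False
    have halving: "\<exists>Y\<in>sets M. Y \<subseteq> X \<and> \<not> null_on M Y \<and> measure M Y \<le> measure M X / 2 ^ n" for n
    proof (induction n)
      case 0
      then show ?case using Xn fin_setsD(1)[OF Xfin] by auto
    next
      case (Suc n)
      then obtain Y where Y: "Y \<in> sets M" "Y \<subseteq> X" "\<not> null_on M Y" "measure M Y \<le> measure M X / 2 ^ n"
        by blast
      then have "\<not> atom Y" using False by blast
      then obtain B where B: "B \<in> sets M" "B \<subseteq> Y" "\<not> null_on M B" "\<not> null_on M (Y - B)"
        using Y unfolding atom_def by blast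
      have fin: "emeasure M Y \<noteq> \<infinity>"
        using fin_setsD(2)[OF fin_sets_subset[OF Xfin Y(1,2)]] by simp
      have "measure M (Y - B) = measure M Y - measure M B"
        using measure_Diff[OF fin Y(1) B(1,2)] .
      then have "measure M B \<le> measure M X / 2 ^ Suc n \<or> measure M (Y - B) \<le> measure M X / 2 ^ Suc n"
      proof -
        have e: "measure M X / 2 ^ Suc n = (measure M X / 2 ^ n) / 2" by simp
        show ?thesis unfolding e using Y(4) \<open>measure M (Y - B) = measure M Y - measure M B\<close> by linarith
      qed
      then show ?case
      proof
        assume "measure M B \<le> measure M X / 2 ^ Suc n"
        then show ?thesis using B Y by (intro bexI[of _ B]) auto
      next
        assume "measure M (Y - B) \<le> measure M X / 2 ^ Suc n"
        then show ?thesis using B Y by (intro bexI[of _ "Y - B"]) auto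
      qed
    qed
    obtain n where n: "measure M X / 2 ^ n \<le> \<epsilon>"
    proof -
      have mp: "measure M X + 1 > 0" using measure_nonneg[of M X] by linarith
      obtain n where "(1 / 2) ^ n < \<epsilon> / (measure M X + 1)"
        using real_arch_pow_inv[OF divide_pos_pos[OF \<epsilon> mp], of "1 / 2"] by auto
      then have "(1 / 2) ^ n * (measure M X + 1) < \<epsilon>"
        using mp by (simp only: pos_less_divide_eq)
      moreover have "measure M X / 2 ^ n \<le> (1 / 2) ^ n * (measure M X + 1)"
        by (simp add: power_divide divide_right_mono)
      ultimately have "measure M X / 2 ^ n \<le> \<epsilon>" by linarith
      then show ?thesis by (rule that)
    qed
    obtain Y where Y: "Y \<in> sets M" "Y \<subseteq> X" "\<not> null_on M Y" "measure M Y \<le> measure M X / 2 ^ n"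
      using halving by blast
    have "emeasure M Y = ennreal (measure M Y)"
      using fin_setsD(2)[OF fin_sets_subset[OF Xfin Y(1,2)]] by (simp add: emeasure_eq_ennreal_measure less_top)
    then have "emeasure M Y \<le> ennreal \<epsilon>" using Y(4) n by (simp add: ennreal_leI)
    moreover have "sub_classes M Y \<lesssim> sub_classes M Y \<times> (UNIV :: bool set)"
      unfolding lepoll_def by (rule exI[of _ "\<lambda>c. (c, True)"]) (auto simp: inj_on_def)
    then have "sub_classes M X \<lesssim> sub_classes M Y \<times> (UNIV :: bool set)"
      using Xle[OF Y(1,2,3)] lepoll_trans by blast
    ultimately show ?thesis using that Y by blast
  qed
qed

text \<open>Zorn's lemma. A nonnull set almost disjoint from a maximal family would contain a
  homogeneous set that could be added to it.\<close>

lemma ex_maximal_homogeneous_family: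
  obtains I where "\<And>X. X \<in> I \<Longrightarrow> homogeneous M X"
    "\<And>X Y. X \<in> I \<Longrightarrow> Y \<in> I \<Longrightarrow> X \<noteq> Y \<Longrightarrow> ae_disj M X Y"
    "\<And>E. E \<in> fin_sets M \<Longrightarrow> (\<And>X. X \<in> I \<Longrightarrow> ae_disj M E X) \<Longrightarrow> null_on M E"
proof -
  define \<A> where "\<A> = {I. (\<forall>X\<in>I. homogeneous M X) \<and> (\<forall>X\<in>I. \<forall>Y\<in>I. X \<noteq> Y \<longrightarrow> ae_disj M X Y)}"
  have "\<exists>I\<in>\<A>. \<forall>I'\<in>\<A>. I \<subseteq> I' \<longrightarrow> I' = I"
  proof (rule subset_Zorn_nonempty)
    show "\<A> \<noteq> {}" by (auto simp: \<A>_def)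
    fix \<C> assume \<C>: "\<C> \<noteq> {}" "subset.chain \<A> \<C>"
    have "ae_disj M X Y" if XY: "X \<in> \<Union>\<C>" "Y \<in> \<Union>\<C>" "X \<noteq> Y" for X Y
    proof -
      have f: "finite {X, Y}" "{X, Y} \<subseteq> \<Union>\<C>" using XY by auto
      obtain I where "I \<in> \<C>" "{X, Y} \<subseteq> I" by (rule finite_subset_Union_chain[OF f \<C>])
      moreover from this have "I \<in> \<A>" using \<C>(2) unfolding subset.chain_def by blast
      ultimately show ?thesis using XY(3) by (auto simp: \<A>_def)
    qed
    moreover have "homogeneous M X" if "X \<in> \<Union>\<C>" for X
      using that \<C>(2) unfolding subset.chain_def \<A>_def by blast
    ultimately show "\<Union>\<C> \<in> \<A>" unfolding \<A>_def by blast
  qed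
  then obtain I where I: "I \<in> \<A>" "\<And>I'. I' \<in> \<A> \<Longrightarrow> I \<subseteq> I' \<Longrightarrow> I' = I" by blast
  show ?thesis
  proof (rule that[of I])
    fix E assume E: "E \<in> fin_sets M" "\<And>X. X \<in> I \<Longrightarrow> ae_disj M E X"
    show "null_on M E"
    proof (rule ccontr)
      assume "\<not> null_on M E"
      then obtain X where X: "X \<subseteq> E" "homogeneous M X" using ex_homogeneous[OF E(1)] by blast
      have d: "ae_disj M X Y" "ae_disj M Y X" if "Y \<in> I" for Y
        using E(2)[OF that] X(1) unfolding ae_disj_def by (auto elim!: eventually_mono)
      have "insert X I \<in> \<A>" using I(1) X(2) d by (simp add: \<A>_def)
      \<comment> \<open>As a member of \<open>I\<close>, the new set would be almost disjoint from
        itself, hence null.\<close>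
      from I(2)[OF this subset_insertI] have "X \<in> I" by blast
      then have "null_on M X" using d(1)[of X] by (simp add: ae_disj_def null_on_def)
      then show False using X(2) by (simp add: homogeneous_def)
    qed
  qed (use I(1) in \<open>auto simp: \<A>_def\<close>)
qed

text \<open>The traces on \<open>E\<close> are almost disjoint, so only finitely many can have
  measure at least 1/(n+1).\<close>

lemma countable_not_ae_disj:
  assumes I: "\<And>X. X \<in> I \<Longrightarrow> X \<in> sets M" "\<And>X Y. X \<in> I \<Longrightarrow> Y \<in> I \<Longrightarrow> X \<noteq> Y \<Longrightarrow> ae_disj M X Y"
    and E: "E \<in> fin_sets M"
  shows "countable {X \<in> I. \<not> ae_disj M E X}"
proof -
  have Es: "E \<in> sets M" and Ef: "emeasure M E < \<infinity>" using fin_setsD[OF E] by auto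
  define L where "L = (\<lambda>n::nat. {X \<in> I. 1 / real (Suc n) \<le> measure M (E \<inter> X)})"
  have fs: "E \<inter> X \<in> fin_sets M" if "X \<in> I" for X
    using fin_sets_subset[OF E] I(1)[OF that] Es by auto
  have em: "emeasure M (E \<inter> X) = ennreal (measure M (E \<inter> X))" if "X \<in> I" for X
    using fin_setsD(2)[OF fs[OF that]] by (simp add: emeasure_eq_ennreal_measure less_top)
  have "finite (L n)" for n
  proof -
    have "card F \<le> nat \<lceil>measure M E * real (Suc n)\<rceil>" if F: "finite F" "F \<subseteq> L n" for F
    proof -
      have FI: "F \<subseteq> I" using F by (auto simp: L_def)
      have "AE x in M. \<forall>X\<in>F. \<forall>Y\<in>F. X \<noteq> Y \<longrightarrow> \<not> (x \<in> X \<and> x \<in> Y)"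
        using I(2) FI F(1) unfolding ae_disj_def
        by (intro AE_finite_allI) auto
      then have ae: "AE x in M. (\<Sum>X\<in>F. indicator (E \<inter> X) x) \<le> (indicator E x :: ennreal)"
      proof eventually_elim
        case (elim x)
        show ?case
        proof (cases "\<exists>X\<in>F. x \<in> E \<inter> X")
          case True
          then obtain X where X: "X \<in> F" "x \<in> E \<inter> X" by blast
          have "(\<Sum>Y\<in>F. indicator (E \<inter> Y) x :: ennreal) = (\<Sum>Y\<in>{X}. indicator (E \<inter> Y) x)"
            using elim X F(1) by (intro sum.mono_neutral_right) (auto simp: indicator_def)
          then show ?thesis using X by simp
        next
          case False
          then have "(\<Sum>Y\<in>F. indicator (E \<inter> Y) x :: ennreal) = 0" by (intro sum.neutral) (auto simp: indicator_def)
          then show ?thesis by simp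
        qed
      qed
      have "ennreal (\<Sum>X\<in>F. measure M (E \<inter> X)) = (\<Sum>X\<in>F. ennreal (measure M (E \<inter> X)))"
        by (rule sum_ennreal[symmetric]) simp
      also have "\<dots> = (\<Sum>X\<in>F. emeasure M (E \<inter> X))"
        by (rule sum.cong[OF refl em[symmetric]]) (use FI in blast)
      also have "\<dots> = (\<integral>\<^sup>+x. (\<Sum>X\<in>F. indicator (E \<inter> X) x) \<partial>M)"
        using I(1) FI Es by (subst nn_integral_sum) (auto intro!: sum.cong)
      also have "\<dots> \<le> (\<integral>\<^sup>+x. indicator E x \<partial>M)" by (rule nn_integral_mono_AE[OF ae])
      also have "\<dots> = ennreal (measure M E)"
        using Es Ef by (simp add: emeasure_eq_ennreal_measure less_top)
      finally have "(\<Sum>X\<in>F. measure M (E \<inter> X)) \<le> measure M E" by simp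
      moreover have "(\<Sum>X\<in>F. 1 / real (Suc n)) \<le> (\<Sum>X\<in>F. measure M (E \<inter> X))"
        using F(2) by (intro sum_mono) (auto simp: L_def)
      ultimately have "real (card F) / real (Suc n) \<le> measure M E" by simp
      then have "real (card F) \<le> measure M E * real (Suc n)" by (simp only: pos_divide_le_eq of_nat_0_less_iff zero_less_Suc)
      then show ?thesis by linarith
    qed
    then show ?thesis using finite_if_finite_subsets_card_bdd[of "L n"] by blast
  qed
  then have "countable (\<Union>n. L n)" by (intro countable_UN) (auto intro: countable_finite)
  moreover have "{X \<in> I. \<not> ae_disj M E X} \<subseteq> (\<Union>n. L n)"
  proof
    fix X assume "X \<in> {X \<in> I. \<not> ae_disj M E X}"
    then have X: "X \<in> I" "\<not> ae_disj M E X" by auto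
    have "emeasure M (E \<inter> X) \<noteq> 0"
      using X(2) null_on_iff[of "E \<inter> X" M] fin_setsD(1)[OF fs[OF X(1)]] by (simp add: ae_disj_def null_on_def)
    then have "measure M (E \<inter> X) \<noteq> 0" using em[OF X(1)] by auto
    then have "measure M (E \<inter> X) > 0" by (simp add: zero_less_measure_iff)
    then obtain n where "inverse (real (Suc n)) < measure M (E \<inter> X)" using reals_Archimedean by blast
    then have "1 / real (Suc n) \<le> measure M (E \<inter> X)" by (simp only: inverse_eq_divide less_imp_le)
    then show "X \<in> (\<Union>n. L n)" using X(1) unfolding L_def by blast
  qed
  ultimately show ?thesis using countable_subset by blast
qed

section \<open>Counting classes and case (b)\<close>

lemma infinite_if_reals_lepoll: "(UNIV :: real set) \<lesssim> Z \<Longrightarrow> infinite Z"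
  using countable_lepoll[of Z "UNIV :: real set"] uncountable_UNIV_real countable_finite by blast

lemma in_seqsI: "(\<And>n. J n \<in> X) \<Longrightarrow> J \<in> seqs X"
  by (simp add: seqs_def)

text \<open>Boundedness counts the classes of positive measure; the null class adds one element,
  absorbed by the infinite \<open>Z\<close>.\<close>

lemma sub_classes_lepoll:
  assumes Z: "infinite Z" "zeta_bounded M Z" and A: "A \<in> fin_sets M"
  shows "sub_classes M A \<lesssim> Z"
proof -
  let ?P = "{ae_sim M `` {B} | B. B \<in> sets M \<and> B \<subseteq> A \<and> emeasure M B > 0}"
  have sub: "sub_classes M A \<subseteq> {ae_sim M `` {{}}} \<union> ?P"
  proof
    fix c assume "c \<in> sub_classes M A"
    then obtain B where B: "B \<in> sets M" "B \<subseteq> A" "c = ae_sim M `` {B}" by (auto simp: sub_classes_def)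
    have Bf: "B \<in> fin_sets M" using fin_sets_subset[OF A B(1,2)] .
    show "c \<in> {ae_sim M `` {{}}} \<union> ?P"
    proof (cases "emeasure M B = 0")
      case True
      then have "c = ae_sim M `` {{}}" using null_class[OF Bf] null_on_iff[OF B(1)] B(3) by simp
      then show ?thesis by simp
    next
      case False
      then have "emeasure M B > 0" by (simp add: zero_less_iff_neq_zero)
      then show ?thesis using B by blast
    qed
  qed
  have P: "?P \<lesssim> Z"
  proof (cases "emeasure M A > 0")
    case True
    then show ?thesis using Z(2) A unfolding zeta_bounded_def by blast
  next
    case False
    then have "emeasure M B = 0" if "B \<subseteq> A" for B
      using emeasure_mono[OF that fin_setsD(1)[OF A]] by (simp add: zero_less_iff_neq_zero)
    then have "?P = {}" by auto
    then show ?thesis by (simp only: empty_lepoll)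
  qed
  have "{ae_sim M `` {{}}} \<union> ?P \<lesssim> Z"
    by (rule Un_lepoll[OF Z(1) finite_lepoll_infinite[OF Z(1)] P]) simp
  then show ?thesis by (rule lepoll_trans[OF subset_imp_lepoll[OF sub]])
qed

lemma bool_seqs_lepoll_reals: "(UNIV :: (nat \<Rightarrow> bool) set) \<lesssim> (UNIV :: real set)"
proof -
  have "(UNIV :: (nat \<Rightarrow> bool) set) \<lesssim> (UNIV :: nat set set)"
    unfolding lepoll_def by (rule exI[of _ Collect]) (auto simp: inj_on_def)
  then show ?thesis using nat_sets_eqpoll_reals by (rule lepoll_trans2)
qed

text \<open>The sequence may repeat sets: a repetition becomes empty, and a first occurrence loses
  only a null set.\<close>

lemma disjointed_ae_disj:
  assumes J: "\<And>m n. J m = J n \<or> ae_disj M (J m) (J n)"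
  shows "disjointed J n = {} \<or> (AE x in M. x \<in> disjointed J n \<longleftrightarrow> x \<in> J n)"
proof (cases "\<exists>m<n. J m = J n")
  case True
  then show ?thesis by (auto simp: disjointed_def)
next
  case False
  then have "AE x in M. m < n \<longrightarrow> \<not> (x \<in> J m \<and> x \<in> J n)" for m
    using J[of m n] by (auto simp: ae_disj_def)
  then have "AE x in M. \<forall>m. m < n \<longrightarrow> \<not> (x \<in> J m \<and> x \<in> J n)" unfolding AE_all_countable by blast
  then have "AE x in M. x \<in> disjointed J n \<longleftrightarrow> x \<in> J n"
    by eventually_elim (auto simp: disjointed_def)
  then show ?thesis by blast
qed

text \<open>Each homogeneous piece \<open>J n\<close> can be shrunk to a piece of measure at most \<open>2\<^sup>-\<^sup>n\<close>
  without losing classes, up to one bit for atoms. The union of the small pieces has finite measure,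
  so \<open>\<zeta>\<close>-boundedness applies to it.\<close>
lemma covered_classes_lepoll:
  fixes J :: "nat \<Rightarrow> 'a set"
  assumes Z: "(UNIV :: real set) \<lesssim> Z" "zeta_bounded M Z"
    and hom: "\<And>n. J n = {} \<or> homogeneous M (J n)"
    and disj: "\<And>m n. J m = J n \<or> ae_disj M (J m) (J n)"
  shows "(\<lambda>E. ae_sim M `` {E}) ` {E \<in> fin_sets M. AE x in M. x \<in> E \<longrightarrow> x \<in> (\<Union>n. J n)} \<lesssim> Z"
proof -
  have Zinf: "infinite Z" using Z(1) by (rule infinite_if_reals_lepoll)
  have Jfin: "J n \<in> fin_sets M" for n using hom[of n] by (auto simp: homogeneous_def empty_fin_sets)
  have ex: "\<exists>Y g. Y \<in> sets M \<and> Y \<subseteq> J n \<and> emeasure M Y \<le> ennreal ((1 / 2) ^ n) \<and>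
      inj_on g (sub_classes M (J n)) \<and> g ` sub_classes M (J n) \<subseteq> sub_classes M Y \<times> (UNIV :: bool set)" for n
  proof (cases "J n = {}")
    case True
    then show ?thesis
      by (intro exI[of _ "{}"] exI[of _ "\<lambda>c. (c, True)"]) (auto simp: inj_on_def)
  next
    case False
    then have "homogeneous M (J n)" using hom by blast
    then obtain Y where Y: "Y \<in> sets M" "Y \<subseteq> J n" "emeasure M Y \<le> ennreal ((1 / 2) ^ n)"
      "sub_classes M (J n) \<lesssim> sub_classes M Y \<times> (UNIV :: bool set)"
      by (rule homogeneous_small[of M "J n" "(1 / 2) ^ n"]) auto
    then show ?thesis unfolding lepoll_def by blast
  qed
  then obtain Y where "\<forall>n. \<exists>g. Y n \<in> sets M \<and> Y n \<subseteq> J n \<and> emeasure M (Y n) \<le> ennreal ((1 / 2) ^ n) \<and>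
      inj_on g (sub_classes M (J n)) \<and> g ` sub_classes M (J n) \<subseteq> sub_classes M (Y n) \<times> (UNIV :: bool set)"
    using choice[of "\<lambda>n Y. \<exists>g. Y \<in> sets M \<and> Y \<subseteq> J n \<and> emeasure M Y \<le> ennreal ((1 / 2) ^ n) \<and>
      inj_on g (sub_classes M (J n)) \<and> g ` sub_classes M (J n) \<subseteq> sub_classes M Y \<times> (UNIV :: bool set)"] by blast
  then obtain g where "\<forall>n. Y n \<in> sets M \<and> Y n \<subseteq> J n \<and> emeasure M (Y n) \<le> ennreal ((1 / 2) ^ n) \<and>
      inj_on (g n) (sub_classes M (J n)) \<and> g n ` sub_classes M (J n) \<subseteq> sub_classes M (Y n) \<times> (UNIV :: bool set)"
    using choice[of "\<lambda>n g. Y n \<in> sets M \<and> Y n \<subseteq> J n \<and> emeasure M (Y n) \<le> ennreal ((1 / 2) ^ n) \<and>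
      inj_on g (sub_classes M (J n)) \<and> g ` sub_classes M (J n) \<subseteq> sub_classes M (Y n) \<times> (UNIV :: bool set)"] by blast
  then have Y: "Y n \<in> sets M" "Y n \<subseteq> J n" "emeasure M (Y n) \<le> ennreal ((1 / 2) ^ n)"
    and g: "inj_on (g n) (sub_classes M (J n))"
      "g n ` sub_classes M (J n) \<subseteq> sub_classes M (Y n) \<times> (UNIV :: bool set)" for n
    by blast+
  have Yfin: "Y n \<in> fin_sets M" for n using fin_sets_subset[OF Jfin Y(1,2)] .
  define A where "A = (\<Union>n. Y n)"
  have A: "A \<in> fin_sets M"
  proof -
    have "emeasure M A \<le> (\<Sum>n. emeasure M (Y n))"
      unfolding A_def using Y(1) by (intro emeasure_subadditive_countably) auto
    also have "\<dots> \<le> (\<Sum>n. ennreal ((1 / 2) ^ n))" by (intro suminf_le allI Y(3)) auto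
    also have "\<dots> = ennreal (\<Sum>n. (1 / 2) ^ n)"
      by (intro suminf_ennreal2 summable_geometric) auto
    also have "\<dots> < \<infinity>" by simp
    finally show ?thesis using Y(1) by (auto simp: fin_sets_def A_def)
  qed
  define D where "D = disjointed J"
  have Dsets: "D n \<in> sets M" for n
    unfolding D_def using sets.range_disjointed_sets[of J M] fin_setsD(1)[OF Jfin] by blast
  have DJ: "D n \<subseteq> J n" for n unfolding D_def by (rule disjointed_subset)
  have Dcases: "D n = {} \<or> (AE x in M. x \<in> D n \<longleftrightarrow> x \<in> J n)" for n
    unfolding D_def by (rule disjointed_ae_disj[OF disj])
  have Ddisj: "x \<notin> D m" if "x \<in> D n" "m \<noteq> n" for x m n
    using disjoint_family_onD[OF disjoint_family_disjointed[of J], of m n] that unfolding D_def by auto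
  define rep where "rep = (\<lambda>n c. SOME B. B \<in> sets M \<and> B \<subseteq> Y n \<and> ae_sim M `` {B} = c)"
  have rep: "rep n c \<in> sets M" "rep n c \<subseteq> Y n" "ae_sim M `` {rep n c} = c" if "c \<in> sub_classes M (Y n)" for n c
  proof -
    have "\<exists>B. B \<in> sets M \<and> B \<subseteq> Y n \<and> ae_sim M `` {B} = c" using that by (auto simp: sub_classes_def)
    then have "rep n c \<in> sets M \<and> rep n c \<subseteq> Y n \<and> ae_sim M `` {rep n c} = c"
      unfolding rep_def by (rule someI_ex)
    then show "rep n c \<in> sets M" "rep n c \<subseteq> Y n" "ae_sim M `` {rep n c} = c" by auto
  qed
  define v where "v = (\<lambda>E n. g n (ae_sim M `` {E \<inter> D n}))"
  \<comment> \<open>Cutting with \<open>D n\<close> makes the coded pieces disjoint, so that each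
    can be recovered from their union.\<close>
  define R where "R = (\<lambda>E n. rep n (fst (v E n)) \<inter> D n)"
  \<comment> \<open>The code of \<open>E\<close> is one class below \<open>A\<close> and a sequence
    of bits, which \<open>\<zeta>\<close>-boundedness and the continuum bound control.\<close>
  define h where "h = (\<lambda>E. (ae_sim M `` {\<Union>n. R E n}, \<lambda>n. snd (v E n)))"
  let ?\<E> = "{E \<in> fin_sets M. AE x in M. x \<in> E \<longrightarrow> x \<in> (\<Union>n. J n)}"
  have cl: "ae_sim M `` {E \<inter> D n} \<in> sub_classes M (J n)" if "E \<in> ?\<E>" for E n
    using that Dsets DJ fin_setsD(1) unfolding sub_classes_def by blast
  have v: "fst (v E n) \<in> sub_classes M (Y n)" if "E \<in> ?\<E>" for E n
    using g(2)[of n] cl[OF that, of n] unfolding v_def by (auto simp: image_subset_iff mem_Times_iff)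
  have Rsets: "R E n \<in> sets M" and RY: "R E n \<subseteq> Y n" and RD: "R E n \<subseteq> D n" if "E \<in> ?\<E>" for E n
    using rep(1,2)[OF v[OF that, of n]] Dsets[of n] unfolding R_def by auto
  have UR: "(\<Union>n. R E n) \<in> sets M" "(\<Union>n. R E n) \<subseteq> A" if "E \<in> ?\<E>" for E
    using Rsets[OF that] RY[OF that] unfolding A_def by blast+
  have "(\<lambda>E. ae_sim M `` {E}) ` ?\<E> \<lesssim> h ` ?\<E>"
  proof (rule image_lepoll_image)
    fix E E' assume E: "E \<in> ?\<E>" "E' \<in> ?\<E>" and eq: "h E = h E'"
    have fin: "E \<in> fin_sets M" "E' \<in> fin_sets M" using E by auto
    have URf: "(\<Union>n. R E n) \<in> fin_sets M" "(\<Union>n. R E' n) \<in> fin_sets M"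
      using fin_sets_subset[OF A] UR[OF E(1)] UR[OF E(2)] by blast+
    have "ae_sim M `` {\<Union>n. R E n} = ae_sim M `` {\<Union>n. R E' n}" using eq by (simp add: h_def)
    then have aeU: "AE x in M. x \<in> (\<Union>n. R E n) \<longleftrightarrow> x \<in> (\<Union>n. R E' n)"
      using ae_class_eq_iff[OF URf] by blast
    have snd_eq: "snd (v E n) = snd (v E' n)" for n
      using eq by (simp add: h_def fun_eq_iff)
    have piece: "AE x in M. x \<in> E \<inter> D n \<longleftrightarrow> x \<in> E' \<inter> D n" for n
    proof (cases "D n = {}")
      case False
      then have DJn: "AE x in M. x \<in> D n \<longleftrightarrow> x \<in> J n" using Dcases by blast
      \<comment> \<open>On \<open>D n\<close> the unions determine the pieces. Off
        \<open>D n\<close> both representatives are empty almost everywhere, since they lie in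
        \<open>Y n\<close> and \<open>D n\<close> agrees with \<open>J n\<close>.\<close>
      have "AE x in M. x \<in> rep n (fst (v E n)) \<longleftrightarrow> x \<in> rep n (fst (v E' n))"
        using aeU DJn
      proof eventually_elim
        case (elim x)
        have in_R: "x \<in> R F n \<longleftrightarrow> x \<in> (\<Union>n. R F n)" if "x \<in> D n" "F \<in> ?\<E>" for F
        proof -
          have "m = n" if "x \<in> R F m" for m
            using RD[OF \<open>F \<in> ?\<E>\<close>, of m] Ddisj[OF \<open>x \<in> D n\<close>, of m] that by blast
          then show ?thesis by blast
        qed
        show ?case
        proof (cases "x \<in> D n")
          case True
          have "x \<in> R E n \<longleftrightarrow> x \<in> R E' n"
            using elim(1) in_R[OF True E(1)] in_R[OF True E(2)] by simp
          then show ?thesis using True by (simp add: R_def)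
        next
          case False
          then have "x \<notin> Y n" using elim Y(2) by blast
          then show ?thesis using rep(2)[OF v[OF E(1), of n]] rep(2)[OF v[OF E(2), of n]] by blast
        qed
      qed
      then have "ae_sim M `` {rep n (fst (v E n))} = ae_sim M `` {rep n (fst (v E' n))}"
        using rep(1,2)[OF v[OF E(1), of n]] rep(1,2)[OF v[OF E(2), of n]] fin_sets_subset[OF Yfin[of n]]
        by (intro ae_class_eq_iff[THEN iffD2]) auto
      then have "fst (v E n) = fst (v E' n)"
        using rep(3)[OF v[OF E(1), of n]] rep(3)[OF v[OF E(2), of n]] by simp
      then have "v E n = v E' n" using snd_eq by (simp add: prod_eq_iff)
      then have "g n (ae_sim M `` {E \<inter> D n}) = g n (ae_sim M `` {E' \<inter> D n})" by (simp only: v_def)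
      then have "ae_sim M `` {E \<inter> D n} = ae_sim M `` {E' \<inter> D n}"
        by (rule inj_onD[OF g(1) _ cl[OF E(1)] cl[OF E(2)]])
      moreover have "E \<inter> D n \<in> fin_sets M" "E' \<inter> D n \<in> fin_sets M"
        using fin_sets_subset[OF fin(1), of "E \<inter> D n"] fin_sets_subset[OF fin(2), of "E' \<inter> D n"]
          fin_setsD(1)[OF fin(1)] fin_setsD(1)[OF fin(2)] Dsets by auto
      ultimately show ?thesis using ae_class_eq_iff by blast
    qed simp
    have "AE x in M. \<forall>n. x \<in> E \<inter> D n \<longleftrightarrow> x \<in> E' \<inter> D n" unfolding AE_all_countable using piece by blast
    moreover have "AE x in M. x \<in> E \<longrightarrow> x \<in> (\<Union>n. J n)" "AE x in M. x \<in> E' \<longrightarrow> x \<in> (\<Union>n. J n)"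
      using E by auto
    ultimately have "AE x in M. x \<in> E \<longleftrightarrow> x \<in> E'"
    proof eventually_elim
      case (elim x)
      have "(\<Union>n. J n) = (\<Union>n. D n)" unfolding D_def by (simp add: UN_disjointed_eq)
      then show ?case using elim by blast
    qed
    then show "ae_sim M `` {E} = ae_sim M `` {E'}" using ae_class_eq_iff fin by blast
  qed
  also have "h ` ?\<E> \<lesssim> sub_classes M A \<times> (UNIV :: (nat \<Rightarrow> bool) set)"
    by (rule subset_imp_lepoll) (use UR in \<open>auto simp: h_def sub_classes_def\<close>)
  also have "\<dots> \<lesssim> Z \<times> Z"
    by (intro times_lepoll_mono sub_classes_lepoll Zinf Z(2) A lepoll_trans[OF bool_seqs_lepoll_reals Z(1)])
  also have "\<dots> \<lesssim> Z" by (rule lepoll_times_self[OF Zinf])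
  finally show ?thesis .
qed

lemma maximal_spaceable_case_b:
  fixes M :: "'a measure"
  assumes p: "p > 1" and Z: "(UNIV :: real set) \<lesssim> Z" "zeta_bounded M Z" "\<not> ent_classes M \<lesssim> Z"
  shows "maximal_spaceable_Lp M p
    (Ls M p - (\<Union>q\<in>{q. 1 \<le> q \<and> q < p}. Ls M q) :: ('a \<Rightarrow> 'k::{real_normed_field,banach}) set)"
proof -
  have Zinf: "infinite Z" using Z(1) by (rule infinite_if_reals_lepoll)
  obtain I where I: "\<And>X. X \<in> I \<Longrightarrow> homogeneous M X"
    "\<And>X Y. X \<in> I \<Longrightarrow> Y \<in> I \<Longrightarrow> X \<noteq> Y \<Longrightarrow> ae_disj M X Y"
    "\<And>E. E \<in> fin_sets M \<Longrightarrow> (\<And>X. X \<in> I \<Longrightarrow> ae_disj M E X) \<Longrightarrow> null_on M E"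
    using ex_maximal_homogeneous_family by blast
  have Ifin: "X \<in> fin_sets M" if "X \<in> I" for X using I(1)[OF that] by (simp add: homogeneous_def)
  \<comment> \<open>The empty set pads sequences when only finitely many members of
    \<open>I\<close>, or none, are needed.\<close>
  define I0 where "I0 = insert {} I"
  define \<E> where "\<E> = (\<lambda>J. {E \<in> fin_sets M. AE x in M. x \<in> E \<longrightarrow> x \<in> (\<Union>n::nat. J n)})"
  have cover: "\<exists>J\<in>seqs I0. E \<in> \<E> J" if E: "E \<in> fin_sets M" for E
  proof -
    define K where "K = insert {} {X \<in> I. \<not> ae_disj M E X}"
    have K: "countable K" "K \<noteq> {}" "K \<subseteq> I0"
      unfolding K_def I0_def using countable_not_ae_disj[of I M E] fin_setsD(1)[OF Ifin] I(2) E by auto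
    define J where "J = from_nat_into K"
    have J: "range J = K" unfolding J_def using range_from_nat_into[OF K(2,1)] .
    have Usets: "(\<Union>n. J n) \<in> sets M"
    proof (rule sets.countable_UN'')
      fix n
      have "J n \<in> I0" using J K(3) by blast
      then show "J n \<in> sets M" using fin_setsD(1)[OF Ifin] by (auto simp: I0_def)
    qed simp
    have Ef: "E - (\<Union>n. J n) \<in> fin_sets M"
      using fin_sets_subset[OF E] fin_setsD(1)[OF E] Usets by auto
    have "null_on M (E - (\<Union>n. J n))"
    proof (rule I(3)[OF Ef])
      fix X assume X: "X \<in> I"
      show "ae_disj M (E - (\<Union>n. J n)) X"
      proof (cases "ae_disj M E X")
        case True
        then show ?thesis unfolding ae_disj_def by (auto elim!: eventually_mono)
      next
        case False
        then have "X \<in> range J" using X J by (simp add: K_def)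
        then have "X \<subseteq> (\<Union>n. J n)" by blast
        then have "\<not> (x \<in> E - (\<Union>n. J n) \<and> x \<in> X)" for x by blast
        then show ?thesis unfolding ae_disj_def by simp
      qed
    qed
    then have "E \<in> \<E> J" using E unfolding \<E>_def null_on_def by (auto elim!: eventually_mono)
    moreover have "J \<in> seqs I0" using J K(3) by (intro in_seqsI) blast
    ultimately show ?thesis by blast
  qed
  have piece: "(\<lambda>E. ae_sim M `` {E}) ` \<E> J \<lesssim> Z" if "J \<in> seqs I0" for J
    unfolding \<E>_def
  proof (rule covered_classes_lepoll[OF Z(1,2)])
    have J: "J n \<in> insert {} I" for n using that by (simp add: seqs_def I0_def)
    show "J n = {} \<or> homogeneous M (J n)" for n using J[of n] I(1) by blast
    show "J m = J n \<or> ae_disj M (J m) (J n)" for m n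
    proof (cases "J m = {} \<or> J n = {}")
      case True
      then show ?thesis by (auto simp: ae_disj_def)
    next
      case False
      then show ?thesis using J[of m] J[of n] I(2) by blast
    qed
  qed
  have "ent_classes M \<subseteq> (\<Union>J\<in>seqs I0. (\<lambda>E. ae_sim M `` {E}) ` \<E> J)"
    using cover unfolding ent_classes_eq by blast
  then have "ent_classes M \<lesssim> (\<Union>J\<in>seqs I0. (\<lambda>E. ae_sim M `` {E}) ` \<E> J)" by (rule subset_imp_lepoll)
  also have "\<dots> \<lesssim> seqs I0 \<times> Z" by (rule UN_lepoll_times[OF piece])
  finally have ent: "ent_classes M \<lesssim> seqs I0 \<times> Z" .
  \<comment> \<open>Otherwise the union bound would give at most \<open>Z\<close> many classes
    altogether.\<close>
  have big: "\<not> seqs I0 \<lesssim> Z"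
  proof
    assume "seqs I0 \<lesssim> Z"
    then have "seqs I0 \<times> Z \<lesssim> Z \<times> Z" by (rule times_lepoll_mono) simp
    from lepoll_trans[OF lepoll_trans[OF ent this] lepoll_times_self[OF Zinf]]
    have "ent_classes M \<lesssim> Z" .
    then show False using Z(3) by blast
  qed
  then have "Z \<lesssim> seqs I0" using lepoll_linear[of Z "seqs I0"] by blast
  then have "seqs I0 \<times> Z \<lesssim> seqs I0 \<times> seqs I0" by (intro times_lepoll_mono) simp_all
  then have entI: "ent_classes M \<lesssim> seqs I0"
    by (rule lepoll_trans[OF lepoll_trans[OF ent] seqs_times_self])
  \<comment> \<open>A countable family would have at most continuum many sequences, contrary to
    \<open>big\<close>.\<close>
  have uncount: "\<not> countable I"
  proof
    assume "countable I"
    then have "countable I0" by (simp add: I0_def)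
    then obtain f :: "_ \<Rightarrow> nat" where "inj_on f I0" by (auto simp: countable_def)
    then have "inj_on (\<lambda>X. real (f X)) I0" by (auto simp: inj_on_def)
    then have "I0 \<lesssim> (UNIV :: real set)" unfolding lepoll_def by blast
    then have "seqs I0 \<lesssim> Z"
      by (rule lepoll_trans[OF lepoll_trans[OF seqs_mono seqs_reals] Z(1)])
    then show False using big by blast
  qed
  \<comment> \<open>Levels group members of \<open>I\<close> with a common positive lower bound on
    their measure.\<close>
  define lev where "lev = (\<lambda>X. LEAST n. 1 / real (Suc n) \<le> measure M X)"
  have lev: "1 / real (Suc (lev X)) \<le> measure M X" if "X \<in> I" for X
  proof -
    have "emeasure M X \<noteq> 0"
      using I(1)[OF that] null_on_iff[OF fin_setsD(1)[OF Ifin[OF that]]] by (simp add: homogeneous_def)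
    moreover have "emeasure M X = ennreal (measure M X)"
      using fin_setsD(2)[OF Ifin[OF that]] by (simp add: emeasure_eq_ennreal_measure less_top)
    ultimately have "measure M X \<noteq> 0" by auto
    then have "measure M X > 0" by (simp add: zero_less_measure_iff)
    then obtain n where "inverse (real (Suc n)) < measure M X" using reals_Archimedean by blast
    then have "1 / real (Suc n) \<le> measure M X" by (simp only: inverse_eq_divide less_imp_le)
    then show ?thesis unfolding lev_def by (rule LeastI)
  qed
  define L where "L = (\<lambda>n. {X \<in> I. lev X = n})"
  \<comment> \<open>Only finite levels are dropped, a countable loss, so \<open>K\<close> is still
    infinite and absorbs the rest of \<open>I0\<close>.\<close>
  define K where "K = {X \<in> I. infinite (L (lev X))}"
  have count: "countable (I - K)"
  proof (rule countable_subset)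
    show "I - K \<subseteq> (\<Union>n\<in>{n. finite (L n)}. L n)" by (auto simp: K_def L_def)
    show "countable (\<Union>n\<in>{n. finite (L n)}. L n)" by (intro countable_UN) (auto intro: countable_finite)
  qed
  have IK0: "I \<subseteq> (I - K) \<union> K" by blast
  have Kunc: "\<not> countable K"
  proof
    assume "countable K"
    then have "countable ((I - K) \<union> K)" by (rule countable_Un[OF count])
    from countable_subset[OF IK0 this] show False using uncount by blast
  qed
  then have Kinf: "infinite K" using countable_finite by blast
  have "countable (insert {} (I - K))" using count by simp
  then obtain f :: "_ \<Rightarrow> nat" where "inj_on f (insert {} (I - K))" by (auto simp: countable_def)
  then have "insert {} (I - K) \<lesssim> (UNIV :: nat set)" unfolding lepoll_def by blast
  also have "(UNIV :: nat set) \<lesssim> K" using Kinf by (simp add: infinite_le_lepoll)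
  finally have "insert {} (I - K) \<union> K \<lesssim> K" by (intro Un_lepoll Kinf) simp_all
  moreover have "I0 \<subseteq> insert {} (I - K) \<union> K" by (auto simp: I0_def)
  ultimately have "I0 \<lesssim> K" using lepoll_trans[OF subset_imp_lepoll] by blast
  then have IK: "seqs I0 \<lesssim> seqs K" by (rule seqs_mono)
  have ex: "\<exists>h. inj_on h (L n \<times> (UNIV :: nat set)) \<and> h ` (L n \<times> UNIV) \<subseteq> L n" if "infinite (L n)" for n
  proof -
    have "L n \<times> (UNIV :: nat set) \<lesssim> L n \<times> L n"
      using that by (intro times_lepoll_mono) (auto simp: infinite_le_lepoll)
    also have "\<dots> \<lesssim> L n" by (rule lepoll_times_self[OF that])
    finally show ?thesis unfolding lepoll_def .
  qed
  then obtain h where h: "\<And>n. infinite (L n) \<Longrightarrow> inj_on (h n) (L n \<times> (UNIV :: nat set))"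
    "\<And>n. infinite (L n) \<Longrightarrow> h n ` (L n \<times> UNIV) \<subseteq> L n" by metis
  \<comment> \<open>Each \<open>X\<close> in \<open>K\<close> receives infinitely many members of
    its own level, different for different \<open>X\<close>, by an injection of
    \<open>L n \<times> UNIV\<close> into \<open>L n\<close>.\<close>
  define A where "A = (\<lambda>X k. h (lev X) (X, k))"
  have AL: "A X k \<in> L (lev X)" if "X \<in> K" for X k
    using h(2)[of "lev X"] that unfolding A_def K_def L_def by blast
  have AI: "A X k \<in> I" "lev (A X k) = lev X" if "X \<in> K" for X k
    using AL[OF that, of k] by (auto simp: L_def)
  show ?thesis
  proof (rule maximal_spaceable_from_sets[OF p Kinf, of A M "\<lambda>X. 1 / real (Suc (lev X))"])
    show "A X k \<in> fin_sets M" if "X \<in> K" for X k using Ifin AI(1)[OF that] by blast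
    show "1 / real (Suc (lev X)) \<le> measure M (A X k)" if "X \<in> K" for X k
      using lev[OF AI(1)[OF that]] AI(2)[OF that] by simp
    fix X X' and k l :: nat assume X: "X \<in> K" "X' \<in> K" "(X, k) \<noteq> (X', l)"
    have "A X k \<noteq> A X' l"
    proof
      assume e: "A X k = A X' l"
      then have lv: "lev X = lev X'" using AI(2)[OF X(1)] AI(2)[OF X(2)] by metis
      have m: "(X, k) \<in> L (lev X) \<times> UNIV" "(X', l) \<in> L (lev X) \<times> UNIV" "infinite (L (lev X))"
        using X lv by (auto simp: K_def L_def)
      have "h (lev X) (X, k) = h (lev X) (X', l)" using e lv by (simp add: A_def)
      then have "(X, k) = (X', l)" by (rule inj_onD[OF h(1)[OF m(3)] _ m(1,2)])
      then show False using X(3) by blast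
    qed
    then show "AE x in M. \<not> (x \<in> A X k \<and> x \<in> A X' l)"
      using I(2)[OF AI(1)[OF X(1)] AI(1)[OF X(2)]] by (simp add: ae_disj_def)
  next
    show "seqs (ent_classes M) \<lesssim> seqs K"
      by (rule lepoll_trans[OF lepoll_trans[OF seqs_mono[OF entI] seqs_seqs] IK])
  qed simp_all
qed

theorem theorem3p5:
  fixes M :: "'a measure" and p :: real
  assumes "emeasure M (space M) = \<infinity>"
    and "p > 1"
    and "((\<exists>r. 1 \<le> r \<and> r < p \<and> (Ls M p - Ls M r :: ('a \<Rightarrow> 'k::{real_normed_field,banach}) set) \<noteq> {})
            \<and> (UNIV :: nat set) \<lesssim> ent_classes M \<and> ent_classes M \<lesssim> (UNIV :: real set))
         \<or> (\<exists>Z :: 'a set set set. (UNIV :: real set) \<lesssim> Z \<and> Z \<lesssim> ent_classes M \<and> \<not> (ent_classes M \<lesssim> Z)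
                \<and> zeta_bounded M Z)"
  shows "maximal_spaceable_Lp M p
           (Ls M p - (\<Union>q\<in>{q. 1 \<le> q \<and> q < p}. Ls M q) :: ('a \<Rightarrow> 'k) set)"
  using assms(3)
proof
  assume "(\<exists>r. 1 \<le> r \<and> r < p \<and> (Ls M p - Ls M r :: ('a \<Rightarrow> 'k) set) \<noteq> {})
            \<and> (UNIV :: nat set) \<lesssim> ent_classes M \<and> ent_classes M \<lesssim> (UNIV :: real set)"
  then obtain r f where "1 \<le> r" "r < p" "f \<in> (Ls M p :: ('a \<Rightarrow> 'k) set)" "f \<notin> Ls M r"
    "ent_classes M \<lesssim> (UNIV :: real set)" by auto
  then show ?thesis by (intro maximal_spaceable_case_a[OF assms(2), of f M r])
next
  assume "\<exists>Z :: 'a set set set. (UNIV :: real set) \<lesssim> Z \<and> Z \<lesssim> ent_classes M \<and> \<not> (ent_classes M \<lesssim> Z)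
                \<and> zeta_bounded M Z"
  then obtain Z :: "'a set set set"
    where "(UNIV :: real set) \<lesssim> Z" "\<not> ent_classes M \<lesssim> Z" "zeta_bounded M Z" by blast
  then show ?thesis by (intro maximal_spaceable_case_b[OF assms(2), of Z])
qed

end
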